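(* Let $X$ be a non-empty dense-in-itself metric space. Then the Hilbert system $\mathrm{KD4G}_1$ is strongly complete over $X$ for $\mathcal L_{[d]}$-formulas, and sound if $\mathrm G_1$ is valid in $X$.
   Context: A metric space is regarded as a topological space with its metric topology; a space is dense in itself if no singleton subset is open. LANGUAGE. $\mathsf{Var}$ is a fixed set of propositional variables (atoms). $\mathcal L_{[d]}$-formulas: atoms; $\top$; $\neg\varphi$; $\varphi\wedge\psi$; $[d]\varphi$. Abbreviations: $\vee,\to,\leftrightarrow$ as usual, $\langle d\rangle\varphi=\neg[d]\neg\varphi$, $\Box^*\varphi=\varphi\wedge[d]\varphi$. SEMANTICS. An assignment into $X$ is a map $h:\mathsf{Var}\to\wp(X)$. Truth $(X,h),x\models\varphi$ at $x\in X$: atoms $p$ are true iff $x\in h(p)$; $\top$ and Booleans as usual; $[d]\varphi$ is true at $x$ iff some open neighbourhood $O$ of $x$ has $\varphi$ true at every $y\in O\setminus\{x\}$. A formula is valid in $X$ if true at every point under every assignment; a scheme is valid if all its instances are. A set $\Gamma$ of formulas is satisfiable in $X$ if there are one assignment $h$ and one point $x\in X$ with $(X,h),x\models\gamma$ for all $\gamma\in\Gamma$. SYSTEM. $\mathrm G_1$ is the scheme of all formulas $[d](\Box^*Q_0\vee\Box^*Q_1)\to([d]\neg Q_0\vee[d]\neg Q_1)$, where $Q_0=\varphi_0\wedge\neg\varphi_1$, $Q_1=\varphi_1\wedge\neg\varphi_0$, and $\varphi_0,\varphi_1$ are arbitrary formulas. $\mathrm{KD4G}_1$: axioms are all instances of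 propositional tautologies; $[d](\varphi\to\psi)\to([d]\varphi\to[d]\psi)$; $\langle d\rangle\top$; $[d]\varphi\to[d][d]\varphi$; $\mathrm G_1$. Rules: modus ponens; from $\varphi$ infer $[d]\varphi$. A Hilbert system $H$ is sound over $X$ if all its theorems are valid in $X$. A formula is $H$-consistent if its negation is not a theorem of $H$; a set is $H$-consistent if the conjunction of each of its finite subsets is. $H$ is strongly complete over $X$ if every countable $H$-consistent set of formulas of its language is satisfiable in $X$. *)

theory Defs
  imports "HOL-Analysis.Analysis"
begin

section \<open>Language\<close>

text \<open>The fixed set of propositional variables is the type \<open>'v\<close>; it may have any cardinality.\<close>

datatype 'v fm =
    Atom 'v
  | Truth ("\<^bold>\<top>")
  | Neg "'v fm" ("\<^bold>\<not> _" [80] 80)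
  | And "'v fm" "'v fm" (infixr "\<^bold>\<and>" 75)
  | Box "'v fm" ("\<box> _" [80] 80)  \<comment> \<open>the derivative box \<open>[d]\<close>\<close>

abbreviation Or :: "'v fm \<Rightarrow> 'v fm \<Rightarrow> 'v fm" (infixr "\<^bold>\<or>" 70)
  where "\<phi> \<^bold>\<or> \<psi> \<equiv> \<^bold>\<not> (\<^bold>\<not> \<phi> \<^bold>\<and> \<^bold>\<not> \<psi>)"

abbreviation Imp :: "'v fm \<Rightarrow> 'v fm \<Rightarrow> 'v fm" (infixr "\<^bold>\<longrightarrow>" 65)
  where "\<phi> \<^bold>\<longrightarrow> \<psi> \<equiv> \<^bold>\<not> \<phi> \<^bold>\<or> \<psi>"

abbreviation Dia :: "'v fm \<Rightarrow> 'v fm" ("\<diamond> _" [80] 80)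
  where "\<diamond> \<phi> \<equiv> \<^bold>\<not> (\<box> (\<^bold>\<not> \<phi>))"

abbreviation Box_star :: "'v fm \<Rightarrow> 'v fm" ("\<box>\<^sup>* _" [80] 80)
  where "\<box>\<^sup>* \<phi> \<equiv> \<phi> \<^bold>\<and> \<box> \<phi>"


section \<open>Semantics\<close>

text \<open>A space is a type of class \<^class>\<open>topological_space\<close> (hence non-empty); predicates about
  the space as a whole receive it as a type argument \<open>TYPE('a)\<close>. The property of being dense in
  itself is the library class \<^class>\<open>perfect_space\<close>.\<close>

primrec truth :: "('v \<Rightarrow> 'a::topological_space set) \<Rightarrow> 'a \<Rightarrow> 'v fm \<Rightarrow> bool" where
  "truth h x (Atom p) \<longleftrightarrow> x \<in> h p"
| "truth h x \<^bold>\<top> \<longleftrightarrow> True"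
| "truth h x (\<^bold>\<not> \<phi>) \<longleftrightarrow> \<not> truth h x \<phi>"
| "truth h x (\<phi> \<^bold>\<and> \<psi>) \<longleftrightarrow> truth h x \<phi> \<and> truth h x \<psi>"
| "truth h x (\<box> \<phi>) \<longleftrightarrow> (\<exists>U. open U \<and> x \<in> U \<and> (\<forall>y\<in>U - {x}. truth h y \<phi>))"

definition valid_in :: "'a::topological_space itself \<Rightarrow> 'v fm \<Rightarrow> bool" where
  "valid_in _ \<phi> \<longleftrightarrow> (\<forall>(h :: 'v \<Rightarrow> 'a set) x. truth h x \<phi>)"

definition scheme_valid_in :: "'a::topological_space itself \<Rightarrow> 'v fm set \<Rightarrow> bool" where
  "scheme_valid_in X S \<longleftrightarrow> (\<forall>\<phi>\<in>S. valid_in X \<phi>)"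

definition satisfiable_in :: "'a::topological_space itself \<Rightarrow> 'v fm set \<Rightarrow> bool" where
  "satisfiable_in _ \<Gamma> \<longleftrightarrow> (\<exists>(h :: 'v \<Rightarrow> 'a set) x. \<forall>\<gamma>\<in>\<Gamma>. truth h x \<gamma>)"


section \<open>The Hilbert system\<close>

text \<open>Tautologies are taken over their own countably infinite supply of variables, not over
  \<open>'v\<close>: if \<open>'v\<close> is finite, tautologies in the variables \<open>'v\<close> alone would have too few
  substitution instances.\<close>

datatype pfm = PVar nat | PTruth | PNeg pfm | PAnd pfm pfm

primrec peval :: "(nat \<Rightarrow> bool) \<Rightarrow> pfm \<Rightarrow> bool" where
  "peval v (PVar n) \<longleftrightarrow> v n"
| "peval v PTruth \<longleftrightarrow> True"
| "peval v (PNeg \<alpha>) \<longleftrightarrow> \<not> peval v \<alpha>"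
| "peval v (PAnd \<alpha> \<beta>) \<longleftrightarrow> peval v \<alpha> \<and> peval v \<beta>"

primrec psubst :: "(nat \<Rightarrow> 'v fm) \<Rightarrow> pfm \<Rightarrow> 'v fm" where
  "psubst \<sigma> (PVar n) = \<sigma> n"
| "psubst \<sigma> PTruth = \<^bold>\<top>"
| "psubst \<sigma> (PNeg \<alpha>) = \<^bold>\<not> (psubst \<sigma> \<alpha>)"
| "psubst \<sigma> (PAnd \<alpha> \<beta>) = psubst \<sigma> \<alpha> \<^bold>\<and> psubst \<sigma> \<beta>"

definition taut_instances :: "'v fm set" where
  "taut_instances = {psubst \<sigma> \<alpha> | \<sigma> \<alpha>. \<forall>v. peval v \<alpha>}"

definition G1_instance :: "'v fm \<Rightarrow> 'v fm \<Rightarrow> 'v fm" where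
  "G1_instance \<phi>\<^sub>0 \<phi>\<^sub>1 =
     (let Q\<^sub>0 = \<phi>\<^sub>0 \<^bold>\<and> \<^bold>\<not> \<phi>\<^sub>1; Q\<^sub>1 = \<phi>\<^sub>1 \<^bold>\<and> \<^bold>\<not> \<phi>\<^sub>0
      in \<box> ((\<box>\<^sup>* Q\<^sub>0) \<^bold>\<or> (\<box>\<^sup>* Q\<^sub>1)) \<^bold>\<longrightarrow> ((\<box> (\<^bold>\<not> Q\<^sub>0)) \<^bold>\<or> (\<box> (\<^bold>\<not> Q\<^sub>1))))"

definition G1 :: "'v fm set" where
  "G1 = {G1_instance \<phi>\<^sub>0 \<phi>\<^sub>1 | \<phi>\<^sub>0 \<phi>\<^sub>1. True}"

inductive KD4G1 :: "'v fm \<Rightarrow> bool" where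
  Taut: "\<phi> \<in> taut_instances \<Longrightarrow> KD4G1 \<phi>"
| K: "KD4G1 (\<box> (\<phi> \<^bold>\<longrightarrow> \<psi>) \<^bold>\<longrightarrow> (\<box> \<phi> \<^bold>\<longrightarrow> \<box> \<psi>))"
| D: "KD4G1 (\<diamond> \<^bold>\<top>)"
| Four: "KD4G1 (\<box> \<phi> \<^bold>\<longrightarrow> \<box> (\<box> \<phi>))"
| G: "\<phi> \<in> G1 \<Longrightarrow> KD4G1 \<phi>"
| MP: "KD4G1 \<phi> \<Longrightarrow> KD4G1 (\<phi> \<^bold>\<longrightarrow> \<psi>) \<Longrightarrow> KD4G1 \<psi>"
| Nec: "KD4G1 \<phi> \<Longrightarrow> KD4G1 (\<box> \<phi>)"


section \<open>Soundness, consistency, strong completeness\<close>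

text \<open>A Hilbert system enters the following notions only through its theoremhood predicate
  \<open>H\<close>.\<close>

definition sound_over :: "('v fm \<Rightarrow> bool) \<Rightarrow> 'a::topological_space itself \<Rightarrow> bool" where
  "sound_over H X \<longleftrightarrow> (\<forall>\<phi>. H \<phi> \<longrightarrow> valid_in X \<phi>)"

definition consistent :: "('v fm \<Rightarrow> bool) \<Rightarrow> 'v fm \<Rightarrow> bool" where
  "consistent H \<phi> \<longleftrightarrow> \<not> H (\<^bold>\<not> \<phi>)"

primrec Conj :: "'v fm list \<Rightarrow> 'v fm" where
  "Conj [] = \<^bold>\<top>"
| "Conj (\<phi> # \<phi>s) = \<phi> \<^bold>\<and> Conj \<phi>s"

text \<open>The conjunction of a finite subset depends on an enumeration of it; all enumerations are
  required to give a consistent formula.\<close>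

definition consistent_set :: "('v fm \<Rightarrow> bool) \<Rightarrow> 'v fm set \<Rightarrow> bool" where
  "consistent_set H \<Gamma> \<longleftrightarrow> (\<forall>\<phi>s. set \<phi>s \<subseteq> \<Gamma> \<longrightarrow> consistent H (Conj \<phi>s))"

definition strongly_complete_over :: "('v fm \<Rightarrow> bool) \<Rightarrow> 'a::topological_space itself \<Rightarrow> bool" where
  "strongly_complete_over H X \<longleftrightarrow>
     (\<forall>\<Gamma>. countable \<Gamma> \<and> consistent_set H \<Gamma> \<longrightarrow> satisfiable_in X \<Gamma>)"

end

theory Submission
  imports Defs
begin

text \<open>Points of the space are labelled by maximal consistent sets. For a finite set \<open>\<Sigma>\<close> of formulas,
  the truth of the members of \<open>\<Sigma>\<close> follows the labels as soon as near every point \<open>x\<close>, with \<open>x\<close>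
  itself left out, exactly the \<open>\<Sigma>\<close>-types of canonical successors of the label of \<open>x\<close> occur, each
  arbitrarily close to \<open>x\<close>. If all successors of a set \<open>b\<close> see the same collection \<open>k\<close> of types as
  \<open>b\<close>, then splitting the whole space into dense sets, one for each type in \<open>k\<close>, gives such a
  labelling, a ``background''. Every maximal consistent set sees such final collections, and by
  \<open>G\<^sub>1\<close> any two final collections seen by \<open>a\<close> are joined by a path whose steps are pairs seen
  by one reflexive successor of \<open>a\<close>. Two backgrounds joined by one step can be placed next to each
  other, the points between them carrying the label of the reflexive successor; hence every type
  seen by \<open>a\<close> can be realised inside an arbitrarily small ball of a given background. A
  point is labelled \<open>a\<close> by surrounding it with a sequence of shrinking disjoint balls treated this
  way. For strong completeness the balls realise types over larger and larger finite sets
  \<open>\<Sigma>\<close>, while a common background is provided by one set \<open>u\<close> above an increasing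
  sequence of sets that are final for the successive \<open>\<Sigma>\<close>.\<close>

section \<open>The canonical frame\<close>

primrec bev :: "('v fm \<Rightarrow> bool) \<Rightarrow> 'v fm \<Rightarrow> bool" where
  "bev v (Atom p) \<longleftrightarrow> v (Atom p)"
| "bev v \<^bold>\<top> \<longleftrightarrow> True"
| "bev v (\<^bold>\<not> \<phi>) \<longleftrightarrow> \<not> bev v \<phi>"
| "bev v (\<phi> \<^bold>\<and> \<psi>) \<longleftrightarrow> bev v \<phi> \<and> bev v \<psi>"
| "bev v (\<box> \<phi>) \<longleftrightarrow> v (\<box> \<phi>)"

primrec prime_parts :: "'v fm \<Rightarrow> 'v fm set" where
  "prime_parts (Atom p) = {Atom p}"
| "prime_parts \<^bold>\<top> = {}"
| "prime_parts (\<^bold>\<not> \<phi>) = prime_parts \<phi>"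
| "prime_parts (\<phi> \<^bold>\<and> \<psi>) = prime_parts \<phi> \<union> prime_parts \<psi>"
| "prime_parts (\<box> \<phi>) = {\<box> \<phi>}"

primrec to_pfm :: "('v fm \<Rightarrow> nat) \<Rightarrow> 'v fm \<Rightarrow> pfm" where
  "to_pfm f (Atom p) = PVar (f (Atom p))"
| "to_pfm f \<^bold>\<top> = PTruth"
| "to_pfm f (\<^bold>\<not> \<phi>) = PNeg (to_pfm f \<phi>)"
| "to_pfm f (\<phi> \<^bold>\<and> \<psi>) = PAnd (to_pfm f \<phi>) (to_pfm f \<psi>)"
| "to_pfm f (\<box> \<phi>) = PVar (f (\<box> \<phi>))"

lemma finite_prime_parts: "finite (prime_parts \<phi>)"
  by (induction \<phi>) auto

lemma peval_to_pfm: "peval v (to_pfm f \<phi>) \<longleftrightarrow> bev (v \<circ> f) \<phi>"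
  by (induction \<phi>) auto

lemma psubst_to_pfm:
  assumes "\<forall>\<psi>\<in>prime_parts \<phi>. \<sigma> (f \<psi>) = \<psi>"
  shows "psubst \<sigma> (to_pfm f \<phi>) = \<phi>"
  using assms by (induction \<phi>) auto

text \<open>Only finitely many atoms and outermost boxed formulas matter in \<open>\<phi>\<close>.
  Numbering these and treating them as propositional variables exhibits \<open>\<phi>\<close> as an
  instance of a \<open>pfm\<close> tautology, whatever the size of \<open>'v\<close>.\<close>

lemma KD4G1_tautology:
  assumes "\<And>v. bev v \<phi>"
  shows "KD4G1 \<phi>"
proof -
  let ?A = "prime_parts \<phi>"
  have "psubst (from_nat_into ?A) (to_pfm (to_nat_on ?A) \<phi>) = \<phi>"
    by (rule psubst_to_pfm) (simp add: countable_finite finite_prime_parts)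
  moreover have "\<forall>v. peval v (to_pfm (to_nat_on ?A) \<phi>)"
    using assms by (simp add: peval_to_pfm)
  ultimately have "\<phi> \<in> taut_instances"
    unfolding taut_instances_def by (smt (verit) mem_Collect_eq)
  then show ?thesis by (rule KD4G1.Taut)
qed

lemma KD4G1_taut_consequence:
  assumes "KD4G1 \<phi>" "\<And>v. bev v \<phi> \<Longrightarrow> bev v \<psi>"
  shows "KD4G1 \<psi>"
  by (rule KD4G1.MP[OF assms(1)], rule KD4G1_tautology) (use assms(2) in auto)

lemma KD4G1_taut_consequence2:
  assumes "KD4G1 \<phi>" "KD4G1 \<theta>" "\<And>v. bev v \<phi> \<Longrightarrow> bev v \<theta> \<Longrightarrow> bev v \<psi>"
  shows "KD4G1 \<psi>"
  by (rule KD4G1.MP[OF assms(1)], rule KD4G1_taut_consequence[OF assms(2)]) (use assms(3) in auto)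

lemma bev_Conj: "bev v (Conj \<phi>s) \<longleftrightarrow> (\<forall>\<phi>\<in>set \<phi>s. bev v \<phi>)"
  by (induction \<phi>s) auto

section \<open>Maximal consistent sets\<close>

definition mcs :: "'v fm set \<Rightarrow> bool" where
  "mcs a \<longleftrightarrow> consistent_set KD4G1 a \<and> (\<forall>\<phi>. \<phi> \<in> a \<or> \<^bold>\<not> \<phi> \<in> a)"

lemma inconsistent_insert:
  assumes "\<not> consistent_set KD4G1 (insert \<phi> a)"
  obtains \<phi>s where "set \<phi>s \<subseteq> a" "KD4G1 (Conj \<phi>s \<^bold>\<longrightarrow> \<^bold>\<not> \<phi>)"
proof -
  obtain \<phi>s where s: "set \<phi>s \<subseteq> insert \<phi> a" "KD4G1 (\<^bold>\<not> (Conj \<phi>s))"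
    using assms by (auto simp: consistent_set_def consistent_def)
  have "KD4G1 (Conj (filter (\<lambda>\<psi>. \<psi> \<noteq> \<phi>) \<phi>s) \<^bold>\<longrightarrow> \<^bold>\<not> \<phi>)"
    by (rule KD4G1_taut_consequence[OF s(2)]) (auto simp: bev_Conj)
  moreover have "set (filter (\<lambda>\<psi>. \<psi> \<noteq> \<phi>) \<phi>s) \<subseteq> a" using s(1) by auto
  ultimately show ?thesis using that by blast
qed

lemma consistent_extend:
  assumes "consistent_set KD4G1 a"
  shows "consistent_set KD4G1 (insert \<phi> a) \<or> consistent_set KD4G1 (insert (\<^bold>\<not> \<phi>) a)"
proof (rule ccontr)
  assume *: "\<not> ?thesis"
  obtain \<phi>s where 1: "set \<phi>s \<subseteq> a" "KD4G1 (Conj \<phi>s \<^bold>\<longrightarrow> \<^bold>\<not> \<phi>)"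
    using * inconsistent_insert by blast
  obtain \<psi>s where 2: "set \<psi>s \<subseteq> a" "KD4G1 (Conj \<psi>s \<^bold>\<longrightarrow> \<^bold>\<not> (\<^bold>\<not> \<phi>))"
    using * inconsistent_insert by blast
  have "KD4G1 (\<^bold>\<not> (Conj (\<phi>s @ \<psi>s)))"
    by (rule KD4G1_taut_consequence2[OF 1(2) 2(2)]) (auto simp: bev_Conj)
  moreover have "set (\<phi>s @ \<psi>s) \<subseteq> a" using 1 2 by auto
  ultimately show False using assms unfolding consistent_set_def consistent_def by blast
qed

text \<open>Zorn's lemma replaces an enumeration of formulas, since \<open>'v\<close> may be
  uncountable. A finite list drawn from the union of a chain already lies in one member of the
  chain, and a maximal element is complete by \<open>consistent_extend\<close>.\<close>

lemma lindenbaum: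
  assumes "consistent_set KD4G1 \<Gamma>"
  obtains a where "mcs a" "\<Gamma> \<subseteq> a"
proof -
  let ?A = "{a. consistent_set KD4G1 a \<and> \<Gamma> \<subseteq> a}"
  have "\<exists>M\<in>?A. \<forall>X\<in>?A. M \<subseteq> X \<longrightarrow> X = M"
  proof (rule subset_Zorn_nonempty)
    show "?A \<noteq> {}" using assms by auto
  next
    fix C assume C: "C \<noteq> {}" "subset.chain ?A C"
    have "consistent KD4G1 (Conj \<phi>s)" if sub: "set \<phi>s \<subseteq> \<Union>C" for \<phi>s
    proof -
      obtain B where "B \<in> C" "set \<phi>s \<subseteq> B"
        using finite_subset_Union_chain[OF finite_set sub C] by blast
      then show ?thesis using C by (auto simp: subset.chain_def consistent_set_def)
    qed
    moreover have "\<Gamma> \<subseteq> \<Union>C" using C by (fastforce simp: subset.chain_def)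
    ultimately show "\<Union>C \<in> ?A" by (auto simp: consistent_set_def)
  qed
  then obtain M where M: "consistent_set KD4G1 M" "\<Gamma> \<subseteq> M"
    and max: "\<And>X. consistent_set KD4G1 X \<Longrightarrow> M \<subseteq> X \<Longrightarrow> X = M"
    by auto
  have "\<phi> \<in> M \<or> \<^bold>\<not> \<phi> \<in> M" for \<phi>
    using consistent_extend[OF M(1), of \<phi>] max[of "insert \<phi> M"] max[of "insert (\<^bold>\<not> \<phi>) M"] by blast
  then show ?thesis using M that by (auto simp: mcs_def)
qed

lemma mcs_deriv:
  assumes "mcs a" "set \<phi>s \<subseteq> a" "KD4G1 (Conj \<phi>s \<^bold>\<longrightarrow> \<phi>)"
  shows "\<phi> \<in> a"
proof (rule ccontr)
  assume "\<phi> \<notin> a"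
  then have "\<^bold>\<not> \<phi> \<in> a" using assms(1) by (auto simp: mcs_def)
  moreover have "KD4G1 (\<^bold>\<not> (Conj (\<^bold>\<not> \<phi> # \<phi>s)))"
    by (rule KD4G1_taut_consequence[OF assms(3)]) (auto simp: bev_Conj)
  ultimately show False
    using assms(1,2) unfolding mcs_def consistent_set_def consistent_def
    by (metis insert_subset list.simps(15))
qed

lemma mcs_theorem: "mcs a \<Longrightarrow> KD4G1 \<phi> \<Longrightarrow> \<phi> \<in> a"
  by (rule mcs_deriv[of a "[]"]) (auto elim: KD4G1_taut_consequence)

lemma mcs_Neg: "mcs a \<Longrightarrow> \<^bold>\<not> \<phi> \<in> a \<longleftrightarrow> \<phi> \<notin> a"
proof -
  assume a: "mcs a"
  have "KD4G1 (\<^bold>\<not> (Conj [\<phi>, \<^bold>\<not> \<phi>]))" by (rule KD4G1_tautology) simp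
  then have "\<not> (\<phi> \<in> a \<and> \<^bold>\<not> \<phi> \<in> a)"
    using a unfolding mcs_def consistent_set_def consistent_def
    by (metis empty_subsetI insert_subset list.set(1) list.simps(15))
  then show ?thesis using a by (auto simp: mcs_def)
qed

lemma mcs_Truth: "mcs a \<Longrightarrow> \<^bold>\<top> \<in> a"
  by (rule mcs_theorem) (auto intro: KD4G1_tautology)

lemma mcs_And:
  assumes a: "mcs a"
  shows "\<phi> \<^bold>\<and> \<psi> \<in> a \<longleftrightarrow> \<phi> \<in> a \<and> \<psi> \<in> a"
proof -
  have 1: "KD4G1 (Conj [\<phi> \<^bold>\<and> \<psi>] \<^bold>\<longrightarrow> \<phi>)"
    by (rule KD4G1_tautology) simp
  have 2: "KD4G1 (Conj [\<phi> \<^bold>\<and> \<psi>] \<^bold>\<longrightarrow> \<psi>)"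
    by (rule KD4G1_tautology) simp
  have 3: "KD4G1 (Conj [\<phi>, \<psi>] \<^bold>\<longrightarrow> \<phi> \<^bold>\<and> \<psi>)"
    by (rule KD4G1_tautology) simp
  show ?thesis
  proof
    assume "\<phi> \<^bold>\<and> \<psi> \<in> a"
    then have "set [\<phi> \<^bold>\<and> \<psi>] \<subseteq> a" by simp
    then show "\<phi> \<in> a \<and> \<psi> \<in> a" using mcs_deriv[OF a _ 1] mcs_deriv[OF a _ 2] by blast
  next
    assume "\<phi> \<in> a \<and> \<psi> \<in> a"
    then have "set [\<phi>, \<psi>] \<subseteq> a" by simp
    then show "\<phi> \<^bold>\<and> \<psi> \<in> a" by (rule mcs_deriv[OF a _ 3])
  qed
qed

section \<open>Canonical successors\<close>

definition Succ :: "'v fm set \<Rightarrow> 'v fm set set" where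
  "Succ a = {b. mcs b \<and> (\<forall>\<phi>. \<box> \<phi> \<in> a \<longrightarrow> \<phi> \<in> b)}"

text \<open>The hypotheses are moved one at a time to the right of the implication; each is then
  discharged under the box by axiom K.\<close>

lemma mcs_box_deriv:
  assumes a: "mcs a" and "\<forall>\<psi>\<in>set \<phi>s. \<box> \<psi> \<in> a" "KD4G1 (Conj \<phi>s \<^bold>\<longrightarrow> \<phi>)"
  shows "\<box> \<phi> \<in> a"
  using assms(2,3)
proof (induction \<phi>s arbitrary: \<phi>)
  case Nil
  have "KD4G1 \<phi>" by (rule KD4G1_taut_consequence[OF Nil(2)]) auto
  then show ?case by (intro mcs_theorem[OF a] KD4G1.Nec)
next
  case (Cons \<psi> \<phi>s)
  have "KD4G1 (Conj \<phi>s \<^bold>\<longrightarrow> (\<psi> \<^bold>\<longrightarrow> \<phi>))"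
    by (rule KD4G1_taut_consequence[OF Cons.prems(2)]) auto
  then have "\<box> (\<psi> \<^bold>\<longrightarrow> \<phi>) \<in> a" using Cons by auto
  moreover have "\<box> \<psi> \<in> a" using Cons.prems by auto
  moreover have "\<box> (\<psi> \<^bold>\<longrightarrow> \<phi>) \<^bold>\<longrightarrow> (\<box> \<psi> \<^bold>\<longrightarrow> \<box> \<phi>) \<in> a"
    by (rule mcs_theorem[OF a KD4G1.K])
  ultimately show ?case using a by (simp add: mcs_And mcs_Neg)
qed

lemma mcs_Box:
  assumes a: "mcs a"
  shows "\<box> \<phi> \<in> a \<longleftrightarrow> (\<forall>b\<in>Succ a. \<phi> \<in> b)"
proof
  show "\<box> \<phi> \<in> a \<Longrightarrow> \<forall>b\<in>Succ a. \<phi> \<in> b" by (auto simp: Succ_def)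
next
  assume *: "\<forall>b\<in>Succ a. \<phi> \<in> b"
  show "\<box> \<phi> \<in> a"
  proof (rule ccontr)
    assume n: "\<box> \<phi> \<notin> a"
    have "consistent_set KD4G1 (insert (\<^bold>\<not> \<phi>) {\<psi>. \<box> \<psi> \<in> a})"
    proof (rule ccontr)
      assume "\<not> ?thesis"
      then obtain \<phi>s where s: "set \<phi>s \<subseteq> {\<psi>. \<box> \<psi> \<in> a}" "KD4G1 (Conj \<phi>s \<^bold>\<longrightarrow> \<^bold>\<not> (\<^bold>\<not> \<phi>))"
        by (rule inconsistent_insert)
      have "KD4G1 (Conj \<phi>s \<^bold>\<longrightarrow> \<phi>)" by (rule KD4G1_taut_consequence[OF s(2)]) auto
      then show False using mcs_box_deriv[OF a] s n by blast
    qed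
    then obtain b where "mcs b" "insert (\<^bold>\<not> \<phi>) {\<psi>. \<box> \<psi> \<in> a} \<subseteq> b" by (rule lindenbaum)
    then show False using * by (auto simp: Succ_def mcs_Neg)
  qed
qed

lemma Succ_mcs: "b \<in> Succ a \<Longrightarrow> mcs b"
  by (simp add: Succ_def)

lemma Succ_nonempty:
  assumes a: "mcs a"
  shows "Succ a \<noteq> {}"
proof -
  have "\<box> (\<^bold>\<not> \<^bold>\<top>) \<notin> a"
    using mcs_theorem[OF a KD4G1.D] mcs_Neg[OF a] by blast
  then show ?thesis using mcs_Box[OF a] by blast
qed

lemma Succ_trans:
  assumes a: "mcs a" and "b \<in> Succ a"
  shows "Succ b \<subseteq> Succ a"
proof
  fix c assume c: "c \<in> Succ b"
  have "\<phi> \<in> c" if "\<box> \<phi> \<in> a" for \<phi>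
  proof -
    have "\<box> (\<box> \<phi>) \<in> a"
      using mcs_theorem[OF a KD4G1.Four, of \<phi>] that a by (simp add: mcs_And mcs_Neg)
    then show ?thesis using assms(2) c by (auto simp: Succ_def)
  qed
  then show "c \<in> Succ a" using c by (auto simp: Succ_def)
qed

section \<open>Definable classes of maximal consistent sets\<close>

definition definable :: "'v fm set set \<Rightarrow> bool" where
  "definable A \<longleftrightarrow> (\<exists>\<phi>. \<forall>a. mcs a \<longrightarrow> (\<phi> \<in> a \<longleftrightarrow> a \<in> A))"

lemma definable_mem: "definable {a. \<phi> \<in> a}"
  by (auto simp: definable_def)

lemma definable_Not: "definable {a. P a} \<Longrightarrow> definable {a. \<not> P a}"
  unfolding definable_def using mcs_Neg by fastforce

lemma definable_True: "definable {a. True}"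
  unfolding definable_def using mcs_Truth by blast

lemma definable_conj:
  assumes "definable {a. P a}" "definable {a. Q a}"
  shows "definable {a. P a \<and> Q a}"
proof -
  obtain \<phi> where \<phi>: "\<And>a. mcs a \<Longrightarrow> \<phi> \<in> a \<longleftrightarrow> P a"
    using assms(1) by (auto simp: definable_def)
  obtain \<psi> where \<psi>: "\<And>a. mcs a \<Longrightarrow> \<psi> \<in> a \<longleftrightarrow> Q a"
    using assms(2) by (auto simp: definable_def)
  show ?thesis
    unfolding definable_def by (rule exI[of _ "\<phi> \<^bold>\<and> \<psi>"]) (simp add: mcs_And \<phi> \<psi>)
qed

lemma definable_disj:
  assumes "definable {a. P a}" "definable {a. Q a}"
  shows "definable {a. P a \<or> Q a}"
proof -
  have "definable {a. \<not> (\<not> P a \<and> \<not> Q a)}"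
    by (intro definable_Not definable_conj assms)
  then show ?thesis by simp
qed

lemma definable_iff:
  assumes "definable {a. P a}" "definable {a. Q a}"
  shows "definable {a. P a \<longleftrightarrow> Q a}"
proof -
  have "definable {a. (P a \<and> Q a) \<or> (\<not> P a \<and> \<not> Q a)}"
    by (intro definable_disj definable_conj definable_Not assms)
  moreover have "{a. (P a \<and> Q a) \<or> (\<not> P a \<and> \<not> Q a)} = {a. P a \<longleftrightarrow> Q a}"
    by blast
  ultimately show ?thesis by simp
qed

lemma definable_const: "definable {a. P}"
  using definable_True definable_Not[OF definable_True] by (cases P) auto

lemma definable_Ball:
  assumes "finite I" "\<And>i. i \<in> I \<Longrightarrow> definable {a. P i a}"
  shows "definable {a. \<forall>i\<in>I. P i a}"
  using assms
proof (induction I)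
  case empty
  show ?case using definable_True by simp
next
  case (insert i I)
  then show ?case using definable_conj[of "P i" "\<lambda>a. \<forall>i\<in>I. P i a"] by simp
qed

text \<open>The box of a defining formula does it. Thus properties stated through successors, such
  as being final, become formulas to which \<open>G\<^sub>1\<close> can be applied.\<close>

lemma definable_all_Succ:
  assumes "definable {a. P a}"
  shows "definable {a. \<forall>b\<in>Succ a. P b}"
proof -
  obtain \<phi> where "\<forall>a. mcs a \<longrightarrow> (\<phi> \<in> a \<longleftrightarrow> P a)" using assms by (auto simp: definable_def)
  then have "\<forall>a. mcs a \<longrightarrow> (\<box> \<phi> \<in> a \<longleftrightarrow> a \<in> {a. \<forall>b\<in>Succ a. P b})"
    using mcs_Box Succ_mcs by blast
  then show ?thesis unfolding definable_def by (rule exI)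
qed

lemma definable_ex_Succ:
  assumes "definable {a. P a}"
  shows "definable {a. \<exists>b\<in>Succ a. P b}"
  using definable_Not[OF definable_all_Succ[OF definable_Not[OF assms]]] by simp

text \<open>All that is used of \<open>G\<^sub>1\<close>: successors cannot be split into two definable, disjoint,
  non-empty up-sets.\<close>

lemma Succ_definably_connected:
  assumes a: "mcs a" and "definable {a. P a}" "definable {a. Q a}"
    and up: "\<And>b c. b \<in> Succ a \<Longrightarrow> c \<in> Succ b \<Longrightarrow> (P b \<longrightarrow> P c) \<and> (Q b \<longrightarrow> Q c)"
    and ex: "\<And>b. b \<in> Succ a \<Longrightarrow> P b \<longleftrightarrow> \<not> Q b"
  shows "(\<forall>b\<in>Succ a. P b) \<or> (\<forall>b\<in>Succ a. Q b)"
proof -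
  obtain \<phi> \<psi> where f: "\<And>a. mcs a \<Longrightarrow> \<phi> \<in> a \<longleftrightarrow> P a" "\<And>a. mcs a \<Longrightarrow> \<psi> \<in> a \<longleftrightarrow> Q a"
    using assms(2,3) by (auto simp: definable_def)
  \<comment> \<open>On the successors of \<open>a\<close>, where \<open>P\<close> and
    \<open>Q\<close> are complementary, \<open>?Q0\<close> amounts to \<open>P\<close> and
    \<open>?Q1\<close> to \<open>Q\<close>.\<close>
  let ?Q0 = "\<phi> \<^bold>\<and> \<^bold>\<not> \<psi>" and ?Q1 = "\<psi> \<^bold>\<and> \<^bold>\<not> \<phi>"
  note mcs_simps = mcs_And mcs_Neg mcs_Box f
  have "G1_instance \<phi> \<psi> \<in> a"
    by (rule mcs_theorem[OF a KD4G1.G]) (auto simp: G1_def)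
  \<comment> \<open>Each successor satisfies one of the two; as both are preserved upwards, it also
    satisfies the box of the same one.\<close>
  moreover have "\<box> ((\<box>\<^sup>* ?Q0) \<^bold>\<or> (\<box>\<^sup>* ?Q1)) \<in> a"
  proof -
    have "(\<box>\<^sup>* ?Q0) \<^bold>\<or> (\<box>\<^sup>* ?Q1) \<in> b" if b: "b \<in> Succ a" for b
    proof -
      have m: "mcs b" using b by (rule Succ_mcs)
      have "c \<in> Succ a" "mcs c" if "c \<in> Succ b" for c
        using Succ_trans[OF a b] that Succ_mcs by auto
      then show ?thesis using m ex[OF b] up[OF b] ex by (auto simp: mcs_simps)
    qed
    then show ?thesis using a by (simp add: mcs_Box)
  qed
  ultimately have "\<box> (\<^bold>\<not> ?Q0) \<in> a \<or> \<box> (\<^bold>\<not> ?Q1) \<in> a"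
    using a by (simp add: G1_instance_def Let_def mcs_And mcs_Neg)
  moreover have "\<^bold>\<not> ?Q0 \<in> b \<longleftrightarrow> \<not> P b" "\<^bold>\<not> ?Q1 \<in> b \<longleftrightarrow> \<not> Q b" if "b \<in> Succ a" for b
    using ex[OF that] Succ_mcs[OF that] by (auto simp: mcs_simps)
  ultimately show ?thesis using ex unfolding mcs_Box[OF a] by blast
qed

text \<open>Any finite set of formulas boxed somewhere along the chain lies in a single late
  \<open>b N\<close>, by transitivity. All these formulas together are therefore consistent, and
  every maximal consistent extension succeeds each \<open>b n\<close>.\<close>

lemma Succ_chain_bound:
  assumes b: "\<And>n. mcs (b n)" "\<And>n. b (Suc n) \<in> Succ (b n)"
  obtains u where "mcs u" "\<And>n. u \<in> Succ (b n)"
proof -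
  have mono: "\<psi> \<in> b m" if "\<box> \<psi> \<in> b n" "n < m" for \<psi> n m
  proof -
    have "b m \<in> Succ (b n)" using that(2)
    proof (induction m)
      case (Suc m)
      show ?case
      proof (cases "n = m")
        case False
        then have "b m \<in> Succ (b n)" using Suc by auto
        then show ?thesis using Succ_trans[OF b(1)] b(2) by blast
      qed (use b in auto)
    qed auto
    then show ?thesis using that by (auto simp: Succ_def)
  qed
  have "consistent_set KD4G1 (\<Union>n. {\<psi>. \<box> \<psi> \<in> b n})"
    unfolding consistent_set_def
  proof (intro allI impI)
    fix \<phi>s :: "'a fm list" assume "set \<phi>s \<subseteq> (\<Union>n. {\<psi>. \<box> \<psi> \<in> b n})"
    then have "\<exists>N. set \<phi>s \<subseteq> b N"
    proof (induction \<phi>s)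
      case (Cons \<phi> \<phi>s)
      have "\<forall>\<psi>\<in>set (\<phi> # \<phi>s). \<exists>n. \<box> \<psi> \<in> b n" using Cons.prems by auto
      then obtain f where f: "\<forall>\<psi>\<in>set (\<phi> # \<phi>s). \<box> \<psi> \<in> b (f \<psi>)" by metis
      \<comment> \<open>The index must be strictly later than all \<open>f \<psi>\<close>: a boxed
        formula is known to hold only at later members.\<close>
      have "f \<psi> < Suc (Max (f ` set (\<phi> # \<phi>s)))" if "\<psi> \<in> set (\<phi> # \<phi>s)" for \<psi>
        using that by (intro le_imp_less_Suc Max_ge) auto
      then show ?case using f mono by blast
    qed auto
    then show "consistent KD4G1 (Conj \<phi>s)" using b(1) by (auto simp: mcs_def consistent_set_def)
  qed
  then obtain u where "mcs u" "(\<Union>n. {\<psi>. \<box> \<psi> \<in> b n}) \<subseteq> u" by (rule lindenbaum)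
  then show ?thesis by (intro that[of u]) (auto simp: Succ_def)
qed


section \<open>Dissecting a perfect metric space\<close>

lemma maximal_separated_subset:
  fixes A :: "'a::metric_space set"
  assumes "e > 0"
  obtains D where "D \<subseteq> A" "\<And>c d. c \<in> D \<Longrightarrow> d \<in> D \<Longrightarrow> dist c d < e \<Longrightarrow> c = d"
    "\<And>x. x \<in> A \<Longrightarrow> \<exists>c\<in>D. dist c x < e"
proof -
  let ?S = "{D. D \<subseteq> A \<and> (\<forall>c\<in>D. \<forall>d\<in>D. dist c d < e \<longrightarrow> c = d)}"
  have "\<exists>M\<in>?S. \<forall>X\<in>?S. M \<subseteq> X \<longrightarrow> X = M"
  proof (rule subset_Zorn_nonempty)
    show "?S \<noteq> {}" by blast
  next
    fix C assume C: "C \<noteq> {}" "subset.chain ?S C"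
    have "c = d" if "c \<in> \<Union>C" "d \<in> \<Union>C" "dist c d < e" for c d
    proof -
      have "finite {c, d}" "{c, d} \<subseteq> \<Union>C" using that by auto
      then obtain B where "B \<in> C" "{c, d} \<subseteq> B"
        using finite_subset_Union_chain C by blast
      then show ?thesis using C that by (auto simp: subset.chain_def)
    qed
    then show "\<Union>C \<in> ?S" using C by (auto simp: subset.chain_def)
  qed
  then obtain M where "M \<in> ?S" and max: "\<forall>X\<in>?S. M \<subseteq> X \<longrightarrow> X = M"
    by (rule bexE)
  then have M: "M \<subseteq> A" "\<forall>c\<in>M. \<forall>d\<in>M. dist c d < e \<longrightarrow> c = d"
    by auto
  have "\<exists>c\<in>M. dist c x < e" if x: "x \<in> A" for x
  proof (rule ccontr)
    assume *: "\<not> ?thesis"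
    then have "insert x M \<in> ?S" using M x by (auto simp: dist_commute)
    from bspec[OF max this] have "x \<in> M" by auto
    then show False using * \<open>e > 0\<close> by force
  qed
  then show ?thesis using that M by blast
qed

text \<open>A small neighbourhood of \<open>z\<close> meets at most one \<open>P c\<close>, and by
  closedness none that misses \<open>z\<close>. Near \<open>z\<close> the union thus coincides with
  that \<open>P c\<close> if \<open>z\<close> lies in it (\<open>F\<close> being at a distance), and
  with \<open>F\<close> otherwise; closedness and interior can be read off piecewise.\<close>

lemma discrete_closed_Union:
  fixes P :: "'c \<Rightarrow> 'a::topological_space set"
  assumes F: "closed F" and P: "\<And>c. c \<in> D \<Longrightarrow> closed (P c)" "\<And>c. c \<in> D \<Longrightarrow> P c \<inter> F = {}"
    and disc: "\<And>z. \<exists>N. open N \<and> z \<in> N \<and>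
      (\<forall>c\<in>D. \<forall>d\<in>D. N \<inter> P c \<noteq> {} \<longrightarrow> N \<inter> P d \<noteq> {} \<longrightarrow> c = d)"
  shows "closed (F \<union> (\<Union>c\<in>D. P c))"
    and "interior (F \<union> (\<Union>c\<in>D. P c)) = interior F \<union> (\<Union>c\<in>D. interior (P c))"
proof -
  have disj: "c = d" if "c \<in> D" "d \<in> D" "z \<in> P c" "z \<in> P d" for c d z
    using disc[of z] that by blast
  have loc: "\<exists>N. open N \<and> z \<in> N \<and> (\<forall>c\<in>D. N \<inter> P c \<noteq> {} \<longrightarrow> z \<in> P c)" for z
  proof -
    obtain N where N: "open N" "z \<in> N"
      "\<And>c d. c \<in> D \<Longrightarrow> d \<in> D \<Longrightarrow> N \<inter> P c \<noteq> {} \<Longrightarrow> N \<inter> P d \<noteq> {} \<Longrightarrow> c = d"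
      using disc by meson
    show ?thesis
    proof (cases "\<exists>c\<in>D. N \<inter> P c \<noteq> {} \<and> z \<notin> P c")
      case True
      then obtain c where c: "c \<in> D" "N \<inter> P c \<noteq> {}" "z \<notin> P c" by blast
      have "open (N - P c)" using N P c by (simp add: open_Diff)
      moreover have "(N - P c) \<inter> P d = {}" if "d \<in> D" for d
        using N(3)[OF c(1) that c(2)] by blast
      ultimately show ?thesis using N c by blast
    next
      case False
      then show ?thesis using N by blast
    qed
  qed
  show "closed (F \<union> (\<Union>c\<in>D. P c))"
    unfolding closed_def
  proof (subst open_subopen, rule ballI)
    fix z assume z: "z \<in> - (F \<union> (\<Union>c\<in>D. P c))"
    obtain N where N: "open N" "z \<in> N" "\<forall>c\<in>D. N \<inter> P c \<noteq> {} \<longrightarrow> z \<in> P c"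
      using loc by blast
    have "open (N \<inter> - F)" "z \<in> N \<inter> - F" using N F z by auto
    moreover have "N \<inter> - F \<subseteq> - (F \<union> (\<Union>c\<in>D. P c))" using N z by auto
    ultimately show "\<exists>T. open T \<and> z \<in> T \<and> T \<subseteq> - (F \<union> (\<Union>c\<in>D. P c))" by blast
  qed
  show "interior (F \<union> (\<Union>c\<in>D. P c)) = interior F \<union> (\<Union>c\<in>D. interior (P c))"
  proof
    show "interior F \<union> (\<Union>c\<in>D. interior (P c)) \<subseteq> interior (F \<union> (\<Union>c\<in>D. P c))"
      by (intro Un_least UN_least interior_mono) auto
  next
    show "interior (F \<union> (\<Union>c\<in>D. P c)) \<subseteq> interior F \<union> (\<Union>c\<in>D. interior (P c))"
    proof
      fix z assume "z \<in> interior (F \<union> (\<Union>c\<in>D. P c))"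
      then obtain T where T: "open T" "z \<in> T" "T \<subseteq> F \<union> (\<Union>c\<in>D. P c)" by (rule interiorE)
      obtain N where N: "open N" "z \<in> N" "\<forall>c\<in>D. N \<inter> P c \<noteq> {} \<longrightarrow> z \<in> P c"
        using loc by blast
      show "z \<in> interior F \<union> (\<Union>c\<in>D. interior (P c))"
      proof (cases "\<exists>c\<in>D. z \<in> P c")
        case True
        then obtain c where c: "c \<in> D" "z \<in> P c" by blast
        have "T \<inter> N \<inter> - F \<subseteq> P c"
        proof
          fix y assume y: "y \<in> T \<inter> N \<inter> - F"
          then obtain d where d: "d \<in> D" "y \<in> P d" using T by blast
          then have "z \<in> P d" using N y by blast
          then show "y \<in> P c" using disj c d by blast
        qed
        moreover have "open (T \<inter> N \<inter> - F)" "z \<in> T \<inter> N \<inter> - F"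
          using T N F c P(2)[OF c(1)] by auto
        ultimately have "z \<in> interior (P c)" by (meson interiorI)
        then show ?thesis using c by blast
      next
        case False
        then have "T \<inter> N \<subseteq> F" using T N by blast
        moreover have "open (T \<inter> N)" "z \<in> T \<inter> N" using T N by auto
        ultimately have "z \<in> interior F" by (meson interiorI)
        then show ?thesis by blast
      qed
    qed
  qed
qed

text \<open>A ball of radius \<open>0\<close> (case \<open>\<not> q\<close>) has empty interior in a perfect space: its centre is
  reserved for the set that remains when the interiors of all balls have been removed.\<close>

definition stage :: "bool \<Rightarrow> real \<Rightarrow> 'a::metric_space set \<Rightarrow> 'a set \<Rightarrow> 'a set \<Rightarrow> ('a \<Rightarrow> real) \<Rightarrow> bool" where
  "stage q e F F' D r \<longleftrightarrow>
     F' = F \<union> (\<Union>c\<in>D. cball c (r c)) \<and> closed F' \<and>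
     interior F' = interior F \<union> (\<Union>c\<in>D. interior (cball c (r c))) \<and>
     (\<forall>c\<in>D. (if q then r c > 0 else r c = 0) \<and> r c < e \<and> cball c (r c) \<inter> F = {}) \<and>
     (\<forall>c\<in>D. \<forall>d\<in>D. cball c (r c) \<inter> cball d (r d) \<noteq> {} \<longrightarrow> c = d) \<and>
     (\<forall>x. x \<notin> F \<longrightarrow> (\<exists>c\<in>D. dist c x < e))"

lemma stageD:
  assumes "stage q e F F' D r"
  shows "F' = F \<union> (\<Union>c\<in>D. cball c (r c))" "closed F'"
    "interior F' = interior F \<union> (\<Union>c\<in>D. interior (cball c (r c)))"
    "\<forall>c\<in>D. (if q then r c > 0 else r c = 0) \<and> r c < e \<and> cball c (r c) \<inter> F = {}"
    "\<forall>c\<in>D. \<forall>d\<in>D. cball c (r c) \<inter> cball d (r d) \<noteq> {} \<longrightarrow> c = d"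
    "\<forall>x. x \<notin> F \<longrightarrow> (\<exists>c\<in>D. dist c x < e)"
  by (insert assms, unfold stage_def, (elim conjE, assumption)+)

lemma ex_stage:
  fixes F :: "'a::metric_space set"
  assumes F: "closed F" and e: "e > 0"
  shows "\<exists>F' D r. stage q e F F' D r"
proof -
  obtain D where D: "D \<subseteq> - F" "\<And>c d. c \<in> D \<Longrightarrow> d \<in> D \<Longrightarrow> dist c d < e \<Longrightarrow> c = d"
    "\<And>x. x \<in> - F \<Longrightarrow> \<exists>c\<in>D. dist c x < e"
    using maximal_separated_subset[OF e] by metis
  \<comment> \<open>Two balls of radius below \<open>e/4\<close> that both meet
    \<open>ball z (e/8)\<close> have centres less than \<open>e\<close> apart, hence equal ones.
    This is the discreteness needed for the union to be closed.\<close>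
  have "\<exists>r. (if q then r > 0 else r = 0) \<and> r < e/4 \<and> cball c r \<inter> F = {}" if c: "c \<in> D" for c
  proof (cases q)
    case True
    have "open (- F)" "c \<in> - F" using F c D by auto
    then obtain r where r: "r > 0" "cball c r \<subseteq> - F" using open_contains_cball by blast
    have "cball c (min r (e/8)) \<subseteq> - F" using r by auto
    then show ?thesis using True r e by (intro exI[of _ "min r (e/8)"]) auto
  qed (use D c e in auto)
  then obtain r where r: "\<And>c. c \<in> D \<Longrightarrow> (if q then r c > 0 else r c = 0)"
    "\<And>c. c \<in> D \<Longrightarrow> r c < e/4" "\<And>c. c \<in> D \<Longrightarrow> cball c (r c) \<inter> F = {}"
    by metis
  have disc: "c = d" if cd: "c \<in> D" "d \<in> D" "ball z (e/8) \<inter> cball c (r c) \<noteq> {}" "ball z (e/8) \<inter> cball d (r d) \<noteq> {}" for c d z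
  proof -
    obtain x where "dist z x < e/8" "dist c x \<le> r c" using cd(3) by auto
    moreover obtain y where "dist z y < e/8" "dist d y \<le> r d" using cd(4) by auto
    moreover have "dist c d \<le> dist c x + dist z x + dist z y + dist d y"
      by metric
    ultimately have "dist c d < e" using r(2)[OF cd(1)] r(2)[OF cd(2)] e by linarith
    then show ?thesis using D cd by blast
  qed
  have *: "\<exists>N. open N \<and> z \<in> N \<and>
      (\<forall>c\<in>D. \<forall>d\<in>D. N \<inter> cball c (r c) \<noteq> {} \<longrightarrow> N \<inter> cball d (r d) \<noteq> {} \<longrightarrow> c = d)" for z
    using disc[of _ _ z] e by (intro exI[of _ "ball z (e/8)"]) auto
  note union = discrete_closed_Union[of F D "\<lambda>c. cball c (r c)", OF F closed_cball r(3) *]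
  have disj: "c = d" if cd: "c \<in> D" "d \<in> D" "cball c (r c) \<inter> cball d (r d) \<noteq> {}" for c d
  proof -
    obtain z where "z \<in> cball c (r c)" "z \<in> cball d (r d)" using cd(3) by blast
    then show ?thesis using disc[OF cd(1,2), of z] e by (metis IntI centre_in_ball empty_iff zero_less_divide_iff zero_less_numeral)
  qed
  have "\<forall>c\<in>D. (if q then r c > 0 else r c = 0) \<and> r c < e \<and> cball c (r c) \<inter> F = {}"
  proof
    fix c assume c: "c \<in> D"
    then show "(if q then r c > 0 else r c = 0) \<and> r c < e \<and> cball c (r c) \<inter> F = {}"
      using r(1)[OF c] r(2)[OF c] r(3)[OF c] e by linarith
  qed
  moreover have "\<forall>x. x \<notin> F \<longrightarrow> (\<exists>c\<in>D. dist c x < e)" using D(3) by blast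
  moreover have "\<forall>c\<in>D. \<forall>d\<in>D. cball c (r c) \<inter> cball d (r d) \<noteq> {} \<longrightarrow> c = d"
    using disj by blast
  ultimately have "stage q e F (F \<union> (\<Union>c\<in>D. cball c (r c))) D r"
    unfolding stage_def by (intro conjI refl union)
  then show ?thesis by blast
qed

text \<open>Stage \<open>m\<close> adds balls around a maximal \<open>e m\<close>-separated set
  outside the closed set \<open>F m\<close> built so far. A point that lies in no interior stays
  outside \<open>interior (F m)\<close> for every \<open>m\<close>, so there are points outside
  \<open>F m\<close>, and then centres of stage \<open>m\<close>, close to it. The flag
  \<open>q m\<close> decides whether stage \<open>m\<close> adds genuine balls or single
  points.\<close>

lemma dissection:
  fixes K :: "'a::{metric_space, perfect_space} set" and q :: "nat \<Rightarrow> bool"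
  assumes "closed K"
  obtains D :: "nat \<Rightarrow> 'a set" and r :: "nat \<Rightarrow> 'a \<Rightarrow> real" where
    "\<And>m c. c \<in> D m \<Longrightarrow> if q m then r m c > 0 else r m c = 0"
    "\<And>m c. c \<in> D m \<Longrightarrow> cball c (r m c) \<inter> K = {}"
    "\<And>m c m' c'. c \<in> D m \<Longrightarrow> c' \<in> D m' \<Longrightarrow> cball c (r m c) \<inter> cball c' (r m' c') \<noteq> {} \<Longrightarrow>
       m = m' \<and> c = c'"
    "\<And>z \<epsilon>. \<epsilon> > 0 \<Longrightarrow> z \<notin> interior K \<Longrightarrow> (\<And>m c. c \<in> D m \<Longrightarrow> z \<notin> interior (cball c (r m c))) \<Longrightarrow>
       \<exists>M. \<forall>m\<ge>M. \<exists>c\<in>D m. cball c (r m c) \<subseteq> ball z \<epsilon>"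
proof -
  define e where "e m = inverse (real (Suc m))" for m
  have e: "e m > 0" for m by (simp add: e_def)
  have "\<exists>F. \<forall>m. (closed (F m) \<and> (m = 0 \<longrightarrow> F m = K)) \<and> (\<exists>D r. stage (q m) (e m) (F m) (F (Suc m)) D r)"
  proof (rule dependent_nat_choice)
    show "\<exists>F. closed F \<and> ((0::nat) = 0 \<longrightarrow> F = K)" using assms by auto
  next
    fix F m assume "closed F \<and> ((m::nat) = 0 \<longrightarrow> F = K)"
    then obtain F' D r where s: "stage (q m) (e m) F F' D r" using ex_stage e by blast
    then have "closed F'" by (rule stageD)
    then show "\<exists>F'. (closed F' \<and> (Suc m = 0 \<longrightarrow> F' = K)) \<and> (\<exists>D r. stage (q m) (e m) F F' D r)"
      using s by blast
  qed
  then obtain F D r where K: "F 0 = K" and st: "\<And>m. stage (q m) (e m) (F m) (F (Suc m)) (D m) (r m)"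
    by metis
  have mono: "F m \<subseteq> F m'" if "m \<le> m'" for m m'
    by (rule lift_Suc_mono_le[OF _ that]) (use stageD(1)[OF st] in blast)
  have int: "interior (F n) = interior K \<union> (\<Union>m<n. \<Union>c\<in>D m. interior (cball c (r m c)))" for n
  proof (induction n)
    case (Suc n)
    have "interior (F (Suc n)) = interior (F n) \<union> (\<Union>c\<in>D n. interior (cball c (r n c)))"
      by (rule stageD[OF st])
    then show ?case using Suc by (auto simp: less_Suc_eq)
  qed (simp add: K)
  have disj: False if "c \<in> D m" "c' \<in> D m'" "cball c (r m c) \<inter> cball c' (r m' c') \<noteq> {}" "m < m'" for m m' c c'
  proof -
    have "cball c (r m c) \<subseteq> F (Suc m)" using stageD(1)[OF st, of m] that by blast
    also have "\<dots> \<subseteq> F m'" using that by (intro mono) auto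
    finally have "cball c (r m c) \<subseteq> F m'" .
    moreover have "cball c' (r m' c') \<inter> F m' = {}" using stageD(4)[OF st, of m'] that by blast
    ultimately show False using that by blast
  qed
  show thesis
  proof (rule that[of D r])
    show "if q m then r m c > 0 else r m c = 0" if "c \<in> D m" for m c
      using stageD(4)[OF st, of m] that by blast
    show "cball c (r m c) \<inter> K = {}" if "c \<in> D m" for m c
      using stageD(4)[OF st, of m] that mono[of 0 m] K by blast
    show "m = m' \<and> c = c'"
      if "c \<in> D m" "c' \<in> D m'" "cball c (r m c) \<inter> cball c' (r m' c') \<noteq> {}" for m c m' c'
    proof -
      have "m = m'" using that disj[of c m c' m'] disj[of c' m' c m] by (metis inf_commute linorder_neqE_nat)
      then show ?thesis using stageD(5)[OF st, of m] that by blast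
    qed
    show "\<exists>M. \<forall>m\<ge>M. \<exists>c\<in>D m. cball c (r m c) \<subseteq> ball z \<epsilon>"
      if eps: "\<epsilon> > 0" "z \<notin> interior K" "\<And>m c. c \<in> D m \<Longrightarrow> z \<notin> interior (cball c (r m c))" for z \<epsilon>
    proof -
      obtain M where M: "e M < \<epsilon>/3"
        \<comment> \<open>One third of \<open>\<epsilon>\<close> each for the way from
          \<open>z\<close> to a point \<open>y\<close> outside \<open>F m\<close>, from
          \<open>y\<close> to a centre, and for the radius.\<close>
        unfolding e_def using reals_Archimedean[of "\<epsilon>/3"] eps(1) by auto
      have "\<exists>c\<in>D m. cball c (r m c) \<subseteq> ball z \<epsilon>" if "m \<ge> M" for m
      proof -
        have "e m \<le> e M" using that by (simp add: e_def field_simps)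
        then have em: "e m < \<epsilon>/3" using M by linarith
        have "z \<notin> interior (F m)" using eps(2,3) by (auto simp: int)
        then have "\<not> ball z (e m) \<subseteq> F m" using e[of m] by (meson centre_in_ball interiorI open_ball)
        then obtain y where "y \<in> ball z (e m)" and y': "y \<notin> F m" by blast
        then have y: "dist z y < e m" "y \<notin> F m" by auto
        then obtain c where c: "c \<in> D m" "dist c y < e m" using stageD(6)[OF st, of m] by blast
        have "r m c < e m" using stageD(4)[OF st, of m] c by blast
        moreover have tri: "dist z x \<le> dist z y + dist c y + dist c x" for x by metric
        ultimately have "dist z x < \<epsilon>" if "dist c x \<le> r m c" for x
          using c(2) y(1) em that tri[of x] by linarith
        then have "cball c (r m c) \<subseteq> ball z \<epsilon>" by auto
        then show ?thesis using c by blast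
      qed
      then show ?thesis by blast
    qed
  qed
qed


section \<open>Dense colourings\<close>

definition visit :: "nat \<Rightarrow> nat" where
  "visit m = fst (prod_decode m)"

lemma visit_infinitely_often: "\<exists>m\<ge>M. visit m = n"
  by (rule exI[of _ "prod_encode (n, M)"]) (simp add: visit_def le_prod_encode_2)

text \<open>With all radii \<open>0\<close> the dissection yields disjoint sets \<open>D m\<close>
  such that every point has points of all late \<open>D m\<close> arbitrarily near. Giving
  \<open>D m\<close> the colour \<open>visit m\<close> makes each colour recur at arbitrarily late
  stages.\<close>

lemma ex_dense_colouring:
  obtains f :: "'a::{metric_space, perfect_space} \<Rightarrow> nat"
  where "\<And>n x e. e > 0 \<Longrightarrow> \<exists>y. y \<noteq> x \<and> dist x y < e \<and> f y = n"
proof -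
  obtain D :: "nat \<Rightarrow> 'a set" and r :: "nat \<Rightarrow> 'a \<Rightarrow> real" where
    D1: "\<And>m c. c \<in> D m \<Longrightarrow> if False then r m c > 0 else r m c = 0" and
    D3: "\<And>m c m' c'. c \<in> D m \<Longrightarrow> c' \<in> D m' \<Longrightarrow> cball c (r m c) \<inter> cball c' (r m' c') \<noteq> {} \<Longrightarrow>
       m = m' \<and> c = c'" and
    D4: "\<And>z \<epsilon>. \<epsilon> > 0 \<Longrightarrow> z \<notin> interior {} \<Longrightarrow> (\<And>m c. c \<in> D m \<Longrightarrow> z \<notin> interior (cball c (r m c))) \<Longrightarrow>
       \<exists>M. \<forall>m\<ge>M. \<exists>c\<in>D m. cball c (r m c) \<subseteq> ball z \<epsilon>"
    by (rule dissection[OF closed_empty, of "\<lambda>_. False"]) blast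
  have r: "r m c = 0" if "c \<in> D m" for m c using D1[OF that] by simp
  have uniq: "m = m'" if "x \<in> D m" "x \<in> D m'" for x m m'
    using D3[OF that] that r by auto
  define f where "f x = visit (SOME m. x \<in> D m)" for x
  have f: "f x = visit m" if "x \<in> D m" for x m
    unfolding f_def using someI[of "\<lambda>m. x \<in> D m", OF that] uniq[OF that] by simp
  show thesis
  proof (rule that[of f])
    fix n x and e :: real assume e: "e > 0"
    have "\<exists>M. \<forall>m\<ge>M. \<exists>c\<in>D m. cball c (r m c) \<subseteq> ball x e"
      by (rule D4) (use e r in auto)
    then obtain M where M: "\<forall>m\<ge>M. \<exists>c\<in>D m. cball c (r m c) \<subseteq> ball x e" by blast
    \<comment> \<open>A stage later than that of \<open>x\<close> itself, if \<open>x\<close> has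
      one, supplies a point different from \<open>x\<close>.\<close>
    obtain m where m: "m \<ge> max M (Suc (SOME m. x \<in> D m))" "visit m = n"
      using visit_infinitely_often by blast
    then obtain c where c: "c \<in> D m" "cball c (r m c) \<subseteq> ball x e" using M by auto
    have "c \<noteq> x"
    proof
      assume "c = x"
      then have "x \<in> D m" using c by simp
      then have "(SOME m. x \<in> D m) = m" using someI[of "\<lambda>m. x \<in> D m"] uniq by blast
      then show False using m by simp
    qed
    moreover have "dist x c < e" using c r by auto
    ultimately show "\<exists>y. y \<noteq> x \<and> dist x y < e \<and> f y = n" using f[OF c(1)] m by blast
  qed
qed


section \<open>Labellings by worlds of a frame\<close>

text \<open>\<open>R a\<close> is the set of successors of \<open>a\<close>, and \<open>t a\<close> is the part of the world \<open>a\<close> that has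
  to be represented faithfully.\<close>

locale typed_frame =
  fixes W :: "'w set" and R :: "'w \<Rightarrow> 'w set" and t :: "'w \<Rightarrow> 't"
  assumes R_W: "a \<in> W \<Longrightarrow> R a \<subseteq> W"
    and R_nonempty: "a \<in> W \<Longrightarrow> R a \<noteq> {}"
    and R_trans: "a \<in> W \<Longrightarrow> b \<in> R a \<Longrightarrow> R b \<subseteq> R a"
    and finite_types: "finite (t ` W)"
begin

definition S :: "'w \<Rightarrow> 't set" where
  "S a = t ` R a"

definition final :: "'w \<Rightarrow> bool" where
  "final b \<longleftrightarrow> (\<forall>c\<in>R b. S c = S b)"

definition Fin :: "'w \<Rightarrow> 't set set" where
  "Fin a = {S b | b. b \<in> R a \<and> final b}"

definition good :: "('x::metric_space \<Rightarrow> 'w) \<Rightarrow> 'x \<Rightarrow> bool" where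
  "good \<rho> x \<longleftrightarrow>
     (\<exists>e>0. \<forall>y. y \<noteq> x \<longrightarrow> dist x y < e \<longrightarrow> t (\<rho> y) \<in> S (\<rho> x)) \<and>
     (\<forall>s\<in>S (\<rho> x). \<forall>e>0. \<exists>y. y \<noteq> x \<and> dist x y < e \<and> t (\<rho> y) = s)"

text \<open>\<open>T\<close> bounds the types in use, so that the labelling may be placed near a
  point whose world sees all of \<open>T\<close>.\<close>

definition labelling :: "'t set \<Rightarrow> ('x::metric_space \<Rightarrow> 'w) \<Rightarrow> bool" where
  "labelling T \<rho> \<longleftrightarrow> (\<forall>x. \<rho> x \<in> W \<and> good \<rho> x \<and> t (\<rho> x) \<in> T)"

definition background :: "'t set \<Rightarrow> ('x::metric_space \<Rightarrow> 'w) \<Rightarrow> bool" where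
  "background k \<beta> \<longleftrightarrow> (\<forall>x. \<beta> x \<in> W \<and> S (\<beta> x) = k \<and> t (\<beta> x) \<in> k) \<and>
     (\<forall>s\<in>k. \<forall>x. \<forall>e>0. \<exists>y. y \<noteq> x \<and> dist x y < e \<and> t (\<beta> y) = s)"

section \<open>Final collections\<close>

lemma S_mono: "a \<in> W \<Longrightarrow> b \<in> R a \<Longrightarrow> S b \<subseteq> S a"
  using R_trans by (auto simp: S_def)

lemma finite_S: "a \<in> W \<Longrightarrow> finite (S a)"
  unfolding S_def by (rule finite_subset[OF _ finite_types]) (use R_W in blast)

lemma t_in_S: "b \<in> R a \<Longrightarrow> t b \<in> S a"
  by (auto simp: S_def)

lemma Fin_mono: "a \<in> W \<Longrightarrow> b \<in> R a \<Longrightarrow> Fin b \<subseteq> Fin a"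
  using R_trans by (fastforce simp: Fin_def)

lemma Fin_subset_S: "a \<in> W \<Longrightarrow> k \<in> Fin a \<Longrightarrow> k \<subseteq> S a"
  using S_mono by (auto simp: Fin_def)

text \<open>A successor seeing the least number of types is final: its own successors see a subset
  of these types, and no fewer of them.\<close>

lemma ex_final:
  assumes "a \<in> W"
  shows "\<exists>b\<in>R a. final b"
proof -
  obtain b where b: "b \<in> R a" "\<And>c. c \<in> R a \<Longrightarrow> card (S b) \<le> card (S c)"
    using ex_has_least_nat[of "\<lambda>b. b \<in> R a" _ "\<lambda>b. card (S b)"] R_nonempty[OF assms] by blast
  have "S c = S b" if c: "c \<in> R b" for c
  proof (rule card_subset_eq)
    have bW: "b \<in> W" using b R_W assms by blast
    show "finite (S b)" using finite_S bW .
    show "S c \<subseteq> S b" using S_mono bW c .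
    then have "card (S c) \<le> card (S b)" using \<open>finite (S b)\<close> by (simp add: card_mono)
    moreover have "c \<in> R a" using R_trans[OF assms b(1)] c by blast
    ultimately show "card (S c) = card (S b)" using b(2) by (simp add: le_antisym)
  qed
  then show ?thesis using b(1) by (auto simp: final_def)
qed

lemma Fin_nonempty: "a \<in> W \<Longrightarrow> Fin a \<noteq> {}"
  using ex_final by (auto simp: Fin_def)

text \<open>A successor of a final world is again final with the same collection. This lets a
  property of \<open>Fin b\<close> for all successors \<open>b\<close> be carried down to
  \<open>Fin a\<close>.\<close>

lemma Fin_seen_above:
  assumes "a \<in> W" "k \<in> Fin a"
  shows "\<exists>b\<in>R a. k \<in> Fin b"
proof -
  obtain b where b: "b \<in> R a" "final b" "k = S b" using assms by (auto simp: Fin_def)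
  have bW: "b \<in> W" using b R_W assms by blast
  obtain c where c: "c \<in> R b" using R_nonempty[OF bW] by blast
  have "final c" unfolding final_def
    using b(2) c R_trans[OF bW c] by (auto simp: final_def)
  moreover have "k = S c" using b c by (simp add: final_def)
  ultimately have "k \<in> Fin b" using c unfolding Fin_def by blast
  then show ?thesis using b(1) by blast
qed

section \<open>Locality of goodness, and backgrounds\<close>

lemma good_cong:
  fixes \<rho> \<rho>' :: "'x::metric_space \<Rightarrow> 'w"
  assumes N: "open N" "x \<in> N" "\<And>y. y \<in> N \<Longrightarrow> \<rho> y = \<rho>' y" and g: "good \<rho> x"
  shows "good \<rho>' x"
proof -
  obtain d where d: "d > 0" "ball x d \<subseteq> N" using N open_contains_ball by blast
  have eq: "\<rho>' y = \<rho> y" if "dist x y < d" for y using N(3) d(2) that by auto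
  have x: "\<rho>' x = \<rho> x" using N by auto
  obtain e where e: "e > 0" "\<forall>y. y \<noteq> x \<longrightarrow> dist x y < e \<longrightarrow> t (\<rho> y) \<in> S (\<rho> x)"
    using g unfolding good_def by blast
  have "\<exists>e>0. \<forall>y. y \<noteq> x \<longrightarrow> dist x y < e \<longrightarrow> t (\<rho>' y) \<in> S (\<rho>' x)"
    using e d eq x by (intro exI[of _ "min d e"]) auto
  moreover have "\<exists>y. y \<noteq> x \<and> dist x y < e' \<and> t (\<rho>' y) = s" if s: "s \<in> S (\<rho>' x)" "e' > 0" for s e'
  proof -
    have "\<forall>e>0. \<exists>y. y \<noteq> x \<and> dist x y < e \<and> t (\<rho> y) = s"
      using g s x unfolding good_def by simp
    then obtain y where "y \<noteq> x" "dist x y < min d e'" "t (\<rho> y) = s" using s d by (metis min_less_iff_conj)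
    then show ?thesis using eq by (intro exI[of _ y]) auto
  qed
  ultimately show ?thesis unfolding good_def by blast
qed

lemma backgroundD:
  assumes "background k \<beta>"
  shows "\<beta> x \<in> W" "S (\<beta> x) = k" "t (\<beta> x) \<in> k" "good \<beta> x"
    and "s \<in> k \<Longrightarrow> e > 0 \<Longrightarrow> \<exists>y. y \<noteq> x \<and> dist x y < e \<and> t (\<beta> y) = s"
proof -
  note b = assms[unfolded background_def]
  show 1: "\<beta> x \<in> W" "S (\<beta> x) = k" "t (\<beta> x) \<in> k" using b by blast+
  show 2: "\<exists>y. y \<noteq> x \<and> dist x y < e \<and> t (\<beta> y) = s" if "s \<in> k" "e > 0" for s e
    using b that by blast
  have "t (\<beta> y) \<in> k" for y using b by blast
  then show "good \<beta> x" unfolding good_def using 1 2 zero_less_one by metis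
qed

text \<open>Colour \<open>n\<close> receives a successor of \<open>a\<close> having the
  \<open>n\<close>-th type of \<open>S a\<close>. Finality of \<open>a\<close> makes all these
  successors see exactly \<open>S a\<close>.\<close>

lemma ex_background:
  assumes a: "a \<in> W" "final a"
  obtains \<beta> :: "'x::{metric_space, perfect_space} \<Rightarrow> 'w" where "background (S a) \<beta>"
proof -
  obtain f :: "'x \<Rightarrow> nat" where f: "\<And>n x e. e > 0 \<Longrightarrow> \<exists>y. y \<noteq> x \<and> dist x y < e \<and> f y = n"
    using ex_dense_colouring by blast
  have ne: "S a \<noteq> {}" using R_nonempty a by (auto simp: S_def)
  have "\<forall>s\<in>S a. \<exists>b\<in>R a. t b = s" by (auto simp: S_def)
  then obtain g where g: "\<And>s. s \<in> S a \<Longrightarrow> g s \<in> R a \<and> t (g s) = s" by metis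
  let ?e = "from_nat_into (S a)"
  have e: "?e n \<in> S a" for n using from_nat_into[OF ne] .
  have "background (S a) (\<lambda>x. g (?e (f x)))"
    unfolding background_def
  proof (intro conjI allI ballI impI)
    fix x
    show "g (?e (f x)) \<in> W" using g[OF e] R_W a by blast
    show "S (g (?e (f x))) = S a" using g[OF e] a by (auto simp: final_def)
    show "t (g (?e (f x))) \<in> S a" using g[OF e] e by metis
  next
    fix s x and e' :: real assume s: "s \<in> S a" "e' > 0"
    have "?e (to_nat_on (S a) s) = s"
      using s finite_S[OF a(1)] by (simp add: countable_finite)
    then show "\<exists>y. y \<noteq> x \<and> dist x y < e' \<and> t (g (?e (f y))) = s"
      using f[OF s(2), of x "to_nat_on (S a) s"] g[OF s(1)] by metis
  qed
  then show thesis by (rule that)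
qed

lemma ex_visiting_sequence:
  assumes a: "a \<in> W"
  obtains w :: "nat \<Rightarrow> 'w" where "\<And>m. w m \<in> R a" "\<And>s M. s \<in> S a \<Longrightarrow> \<exists>m\<ge>M. t (w m) = s"
proof -
  have ne: "S a \<noteq> {}" using R_nonempty a by (auto simp: S_def)
  have "\<forall>s\<in>S a. \<exists>b\<in>R a. t b = s" by (auto simp: S_def)
  then obtain g where g: "\<And>s. s \<in> S a \<Longrightarrow> g s \<in> R a \<and> t (g s) = s" by metis
  let ?w = "\<lambda>m. g (from_nat_into (S a) (visit m))"
  have e: "from_nat_into (S a) n \<in> S a" for n using from_nat_into[OF ne] .
  show thesis
  proof (rule that[of ?w])
    show "?w m \<in> R a" for m using g[OF e] by blast
    fix s M assume s: "s \<in> S a"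
    obtain m where m: "m \<ge> M" "visit m = to_nat_on (S a) s" using visit_infinitely_often by blast
    have "from_nat_into (S a) (to_nat_on (S a) s) = s"
      using s finite_S[OF a(1)] by (simp add: countable_finite)
    then show "\<exists>m\<ge>M. t (?w m) = s" using m g[OF s] by metis
  qed
qed

text \<open>In the dissection driven by a sequence \<open>w\<close> that visits every type of \<open>S a\<close> infinitely
  often, the balls carry labellings around worlds seeing fewer types than \<open>a\<close>, and the
  remaining set carries \<open>a\<close> and its successors that see the same types as \<open>a\<close>.\<close>

lemma reflexive_fill:
  fixes \<eta> :: "'x::{metric_space, perfect_space} \<Rightarrow> 'w"
  assumes a: "a \<in> W" "t a \<in> S a" and K: "closed K"
    and \<eta>: "\<And>x. x \<in> interior K \<Longrightarrow> \<eta> x \<in> W \<and> good \<eta> x \<and> t (\<eta> x) \<in> S a"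
    and small: "\<And>b y. b \<in> R a \<Longrightarrow> S b \<noteq> S a \<Longrightarrow>
      \<exists>\<rho>::'x \<Rightarrow> 'w. labelling (S a) \<rho> \<and> \<rho> y = b"
  obtains \<rho> where "labelling (S a) \<rho>" "\<And>x. x \<in> interior K \<Longrightarrow> \<rho> x = \<eta> x"
    "\<And>x. x \<in> K \<Longrightarrow> x \<notin> interior K \<Longrightarrow> \<rho> x = a"
proof -
  obtain w :: "nat \<Rightarrow> 'w" where w: "\<And>m. w m \<in> R a" "\<And>s M. s \<in> S a \<Longrightarrow> \<exists>m\<ge>M. t (w m) = s"
    using ex_visiting_sequence[OF a(1)] by metis
  \<comment> \<open>If \<open>w m\<close> sees fewer types than \<open>a\<close>, it needs a ball
    with its own labelling inside; if it sees the same types, a single point labelled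
    \<open>w m\<close> fits among the labels \<open>a\<close>.\<close>
  define q where "q m \<longleftrightarrow> S (w m) \<noteq> S a" for m
  obtain D :: "nat \<Rightarrow> 'x set" and r :: "nat \<Rightarrow> 'x \<Rightarrow> real" where
    D1: "\<And>m c. c \<in> D m \<Longrightarrow> if q m then r m c > 0 else r m c = 0" and
    D2: "\<And>m c. c \<in> D m \<Longrightarrow> cball c (r m c) \<inter> K = {}" and
    D3: "\<And>m c m' c'. c \<in> D m \<Longrightarrow> c' \<in> D m' \<Longrightarrow> cball c (r m c) \<inter> cball c' (r m' c') \<noteq> {} \<Longrightarrow>
       m = m' \<and> c = c'" and
    D4: "\<And>z \<epsilon>. \<epsilon> > 0 \<Longrightarrow> z \<notin> interior K \<Longrightarrow> (\<And>m c. c \<in> D m \<Longrightarrow> z \<notin> interior (cball c (r m c))) \<Longrightarrow>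
       \<exists>M. \<forall>m\<ge>M. \<exists>c\<in>D m. cball c (r m c) \<subseteq> ball z \<epsilon>"
    by (rule dissection[OF K, of q]) blast
  have mem: "c \<in> cball c (r m c)" if "c \<in> D m" for m c
    using D1[OF that] by (auto split: if_splits)
  have "\<forall>m (c::'x). \<exists>\<rho>::'x \<Rightarrow> 'w. q m \<longrightarrow> labelling (S a) \<rho> \<and> \<rho> c = w m"
    using small[OF w(1)] unfolding q_def by blast
  then obtain \<sigma> :: "nat \<Rightarrow> 'x \<Rightarrow> 'x \<Rightarrow> 'w"
    where \<sigma>: "\<And>m c. q m \<Longrightarrow> labelling (S a) (\<sigma> m c) \<and> \<sigma> m c c = w m"
    by metis
  let ?P = "\<lambda>x (m, c). c \<in> D m \<and> x \<in> cball c (r m c)"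
  define inside where "inside x \<longleftrightarrow> (\<exists>m c. c \<in> D m \<and> x \<in> interior (cball c (r m c)))" for x
  define piece where "piece x = (SOME p. ?P x p)" for x
  have piece: "piece x = (m, c)" if "c \<in> D m" "x \<in> cball c (r m c)" for x m c
  proof -
    have "?P x (piece x)"
      unfolding piece_def by (rule someI[of "?P x" "(m, c)"]) (use that in simp)
    then obtain m' c' where "piece x = (m', c')" "c' \<in> D m'" "x \<in> cball c' (r m' c')"
      by (cases "piece x") auto
    then show ?thesis using D3[of c m c' m'] that by blast
  qed
  \<comment> \<open>The four cases are the prescribed part, the interiors of balls, the centres of
    radius \<open>0\<close>, and the rest. The rest, labelled \<open>a\<close>, includes the
    boundary of \<open>K\<close> and the boundaries of the balls.\<close>
  define \<rho> where "\<rho> x = (if x \<in> interior K then \<eta> x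
      else if inside x then \<sigma> (fst (piece x)) (snd (piece x)) x
      else if \<exists>m. x \<in> D m then w (fst (piece x)) else a)" for x
  have int_q: "q m" if "c \<in> D m" "x \<in> interior (cball c (r m c))" for m c x
    using D1[OF that(1)] that(2) by (cases "q m") auto
  have rho_F0: "\<rho> x = \<eta> x" if "x \<in> interior K" for x
    using that by (simp add: \<rho>_def)
  have rho_in: "\<rho> x = \<sigma> m c x" if "c \<in> D m" "x \<in> interior (cball c (r m c))" for m c x
  proof -
    have "x \<in> cball c (r m c)" using that interior_subset by blast
    then have "piece x = (m, c)" "x \<notin> interior K"
      using piece that D2[OF that(1)] interior_subset by blast+
    moreover have "inside x" using that unfolding inside_def by blast
    ultimately show ?thesis by (simp add: \<rho>_def)
  qed
  have rho_c: "\<rho> c = w m" if c: "c \<in> D m" for c m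
  proof (cases "q m")
    case True
    have "ball c (r m c) \<subseteq> interior (cball c (r m c))" by (intro interior_maximal) auto
    then have "c \<in> interior (cball c (r m c))" using D1[OF c] True by auto
    then show ?thesis using rho_in[OF c] \<sigma> True by simp
  next
    case False
    have "piece c = (m, c)" using piece[OF c mem[OF c]] .
    moreover have "\<not> inside c"
    proof
      assume "inside c"
      then obtain m' c' where *: "c' \<in> D m'" "c \<in> interior (cball c' (r m' c'))"
        unfolding inside_def by blast
      then have "piece c = (m', c')" using piece interior_subset by blast
      then show False using int_q[OF *] False \<open>piece c = (m, c)\<close> by simp
    qed
    moreover have "c \<notin> interior K" using D2[OF c] mem[OF c] interior_subset by blast
    ultimately show ?thesis using c by (auto simp: \<rho>_def)
  qed
  have rho_Z: "S (\<rho> x) = S a \<and> \<rho> x \<in> W \<and> t (\<rho> x) \<in> S a" if x: "x \<notin> interior K" "\<not> inside x" for x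
  proof (cases "\<exists>m. x \<in> D m")
    case True
    then obtain m where m: "x \<in> D m" by blast
    have "\<not> q m"
    proof
      assume "q m"
      then have "x \<in> ball x (r m x)" using D1[OF m] by auto
      also have "ball x (r m x) \<subseteq> interior (cball x (r m x))" by (intro interior_maximal) auto
      finally show False using x m unfolding inside_def by blast
    qed
    then show ?thesis using rho_c[OF m] w(1)[of m] R_W[OF a(1)] t_in_S unfolding q_def by auto
  next
    case False
    then show ?thesis using x a by (simp add: \<rho>_def)
  qed
  have types: "\<rho> x \<in> W \<and> t (\<rho> x) \<in> S a" for x
  proof (cases "inside x")
    case True
    then obtain m c where *: "c \<in> D m" "x \<in> interior (cball c (r m c))" unfolding inside_def by blast
    then show ?thesis using rho_in[OF *] \<sigma>[OF int_q[OF *]] unfolding labelling_def by simp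
  next
    case False
    then show ?thesis using rho_Z[of x] \<eta>[of x] rho_F0[of x] by (cases "x \<in> interior K") auto
  qed
  have good: "good \<rho> x" for x
  proof -
    consider "x \<in> interior K" | "inside x" | "x \<notin> interior K" "\<not> inside x" by blast
    then show ?thesis
    proof cases
      case 1
      then show ?thesis
        using good_cong[of "interior K" x \<eta> \<rho>] \<eta>[of x] rho_F0 by simp
    next
      case 2
      then obtain m c where *: "c \<in> D m" "x \<in> interior (cball c (r m c))" unfolding inside_def by blast
      have "good (\<sigma> m c) x" using \<sigma>[OF int_q[OF *]] unfolding labelling_def by blast
      then show ?thesis
        using good_cong[of "interior (cball c (r m c))" x "\<sigma> m c" \<rho>] rho_in[OF *(1)] * by simp
    next
      case 3
      \<comment> \<open>Every late stage has a ball near a remaining point, and its centre carries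
        \<open>w m\<close>, so each type of \<open>S a\<close> accumulates there. A stage beyond
        that of the piece containing \<open>x\<close> avoids choosing \<open>x\<close>
        itself.\<close>
      have "\<exists>y. y \<noteq> x \<and> dist x y < e \<and> t (\<rho> y) = s" if s: "s \<in> S a" "e > 0" for s e
      proof -
        obtain M where M: "\<forall>m\<ge>M. \<exists>c\<in>D m. cball c (r m c) \<subseteq> ball x e"
          using D4[OF s(2) 3(1)] 3(2) unfolding inside_def by blast
        obtain m where m: "m \<ge> max M (Suc (fst (piece x)))" "t (w m) = s" using w(2)[OF s(1)] by blast
        then obtain c where c: "c \<in> D m" "cball c (r m c) \<subseteq> ball x e" using M by auto
        have "c \<noteq> x"
        proof
          assume "c = x"
          then have "fst (piece x) = m" using piece[of x m x] c mem by auto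
          then show False using m by simp
        qed
        moreover have "c \<in> ball x e" using c mem[OF c(1)] by blast
        ultimately show ?thesis using rho_c[OF c(1)] m by auto
      qed
      then show ?thesis unfolding good_def using rho_Z[OF 3] types zero_less_one by metis
    qed
  qed
  show thesis
  proof (rule that[of \<rho>])
    show "labelling (S a) \<rho>" unfolding labelling_def using types good by blast
    show "\<rho> x = \<eta> x" if "x \<in> interior K" for x using rho_F0 that .
    fix x assume x: "x \<in> K" "x \<notin> interior K"
    then have "\<not> inside x" unfolding inside_def using D2 interior_subset by blast
    moreover have "\<not> (\<exists>m. x \<in> D m)" using x D2 mem by blast
    ultimately show "\<rho> x = a" using x by (simp add: \<rho>_def)
  qed
qed

end

text \<open>The perturbations are centred at points \<open>y n\<close> tending to \<open>p\<close> so fast that they take place in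
  disjoint shells around \<open>p\<close>.\<close>

lemma perturb_near_point:
  fixes \<beta> :: "'x::{metric_space, perfect_space} \<Rightarrow> 'w" and G :: "nat \<Rightarrow> ('x \<Rightarrow> 'w) \<Rightarrow> bool"
  assumes r: "r > 0"
    and pert: "\<And>n y e. e > 0 \<Longrightarrow>
      \<exists>\<sigma>. G n \<sigma> \<and> (\<forall>x. dist y x \<ge> e \<longrightarrow> \<sigma> x = \<beta> x) \<and> (\<exists>x. dist y x < e \<and> A n (\<sigma> x))"
  obtains \<rho> where "\<rho> p = v" "\<And>x. dist p x \<ge> r \<Longrightarrow> \<rho> x = \<beta> x"
    "\<And>x. x \<noteq> p \<Longrightarrow> \<exists>m \<sigma> N. G m \<sigma> \<and> open N \<and> x \<in> N \<and> (\<forall>y\<in>N. \<sigma> y = \<rho> y)"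
    "\<And>n. \<exists>e>0. \<forall>x. x \<noteq> p \<longrightarrow> dist p x < e \<longrightarrow>
      (\<exists>m\<ge>n. \<exists>\<sigma> N. G m \<sigma> \<and> open N \<and> x \<in> N \<and> (\<forall>y\<in>N. \<sigma> y = \<rho> y))"
    "\<And>e. e > 0 \<Longrightarrow> \<exists>M. \<forall>m\<ge>M. \<exists>x. x \<noteq> p \<and> dist p x < e \<and> A m (\<rho> x)"
proof -
  have near: "\<exists>y. y \<noteq> p \<and> dist p y < e" if "e > 0" for e
    using perfect_choose_dist[OF that, of p] by (auto simp: dist_commute)
  have "\<exists>y. \<forall>n. (y n \<noteq> p \<and> dist p (y n) < min (r/2) (inverse (real (Suc n)))) \<and>
      dist p (y (Suc n)) < dist p (y n) / 3"
  proof (rule dependent_nat_choice)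
    show "\<exists>y. y \<noteq> p \<and> dist p y < min (r/2) (inverse (real (Suc 0)))"
      using r by (intro near) auto
    fix y n assume "y \<noteq> p \<and> dist p y < min (r/2) (inverse (real (Suc n)))"
    then have "min (dist p y / 3) (min (r/2) (inverse (real (Suc (Suc n))))) > 0"
      using r by auto
    from near[OF this] show "\<exists>y'. (y' \<noteq> p \<and> dist p y' < min (r/2) (inverse (real (Suc (Suc n))))) \<and>
        dist p y' < dist p y / 3"
      by auto
  qed
  then obtain y where y: "\<And>n. y n \<noteq> p" "\<And>n. dist p (y n) < r/2"
    "\<And>n. dist p (y n) < inverse (real (Suc n))" "\<And>n. dist p (y (Suc n)) < dist p (y n) / 3"
    by (metis min_less_iff_conj)
  \<comment> \<open>The perturbation stays within \<open>e n / 2\<close>, a third of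
    \<open>dist p (y n)\<close>, of \<open>y n\<close>, hence in the shell at distances between
    \<open>e n\<close> and \<open>2 * e n\<close> from \<open>p\<close>. Since the distances of the
    \<open>y n\<close> drop by more than a factor 3, the shells are disjoint.\<close>
  define e where "e n = 2/3 * dist p (y n)" for n
  have e_pos: "e n > 0" for n using y(1)[of n] by (simp add: e_def)
  have e_Suc: "2 * e (Suc n) < e n" for n
    using y(4)[of n] zero_le_dist[of p "y (Suc n)"] unfolding e_def by linarith
  have e_mono: "e m \<le> e n" if "n \<le> m" for m n
    by (rule lift_Suc_antimono_le[OF _ that]) (use e_Suc e_pos in \<open>smt (verit)\<close>)
  have shell: "e n < dist p x \<and> dist p x < 2 * e n" if "dist (y n) x < e n / 2" for n x
    using that dist_triangle[of p "y n" x] dist_triangle[of p x "y n"]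
    by (simp add: e_def dist_commute)
  have e_lim: "\<exists>n. e n < \<epsilon>" if pos: "\<epsilon> > 0" for \<epsilon>
  proof -
    obtain n where "inverse (real (Suc n)) < \<epsilon>" using reals_Archimedean[OF pos] by blast
    then have "dist p (y n) < \<epsilon>" using y(3)[of n] by linarith
    then have "e n < \<epsilon>" using zero_le_dist[of p "y n"] pos by (simp add: e_def)
    then show ?thesis by blast
  qed
  have "\<forall>n. \<exists>\<sigma>. G n \<sigma> \<and> (\<forall>x. dist (y n) x \<ge> e n / 2 \<longrightarrow> \<sigma> x = \<beta> x) \<and>
      (\<exists>x. dist (y n) x < e n / 2 \<and> A n (\<sigma> x))"
    by (intro allI pert half_gt_zero e_pos)
  then obtain \<sigma> where \<sigma>: "\<And>n. G n (\<sigma> n)" "\<And>n x. dist (y n) x \<ge> e n / 2 \<Longrightarrow> \<sigma> n x = \<beta> x"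
    "\<And>n. \<exists>x. dist (y n) x < e n / 2 \<and> A n (\<sigma> n x)"
    by metis
  have uniq: "m = n" if "dist (y m) x < e m / 2" "dist (y n) x < e n / 2" for m n x
  proof (rule ccontr)
    assume "m \<noteq> n"
    then consider "m < n" | "n < m" by linarith
    then show False
    proof cases
      case 1
      then have "2 * e n < e m" using e_Suc[of m] e_mono[of "Suc m" n] by simp
      then show False using shell[OF that(1)] shell[OF that(2)] by simp
    next
      case 2
      then have "2 * e m < e n" using e_Suc[of n] e_mono[of "Suc n" m] by simp
      then show False using shell[OF that(1)] shell[OF that(2)] by simp
    qed
  qed
  define \<rho> where "\<rho> x = (if x = p then v
      else if \<exists>n. dist (y n) x < e n / 2 then \<sigma> (THE n. dist (y n) x < e n / 2) x else \<beta> x)" for x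
  have rho_in: "\<rho> x = \<sigma> n x" if "dist (y n) x < e n / 2" for x n
  proof -
    have "(THE n. dist (y n) x < e n / 2) = n" using that uniq by (intro the_equality) auto
    moreover have "x \<noteq> p" using shell[OF that] e_pos[of n] by auto
    ultimately show ?thesis using that by (auto simp: \<rho>_def)
  qed
  have rho_out: "\<rho> x = \<beta> x" if "\<And>n. dist (y n) x \<ge> e n / 2" "x \<noteq> p" for x
    using that by (auto simp: \<rho>_def not_less[symmetric])
  \<comment> \<open>An open annulus around shell \<open>n\<close> that avoids all other shells, so
    that only \<open>\<sigma> n\<close> is visible in it. The innermost index \<open>0\<close> of
    the definition has no outer bound, as no shell precedes it.\<close>
  define N where "N n = {x. 2 * e (Suc n) < dist p x \<and> (n = 0 \<or> dist p x < e (n - 1))}" for n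
  have open_N: "open (N n)" for n
  proof (cases n)
    case 0
    then have "N n = {x. 2 * e (Suc n) < dist p x}" by (simp add: N_def)
    then show ?thesis by (simp add: open_Collect_less continuous_on_dist)
  next
    case (Suc k)
    then have "N n = {x. 2 * e (Suc n) < dist p x} \<inter> {x. dist p x < e k}" by (auto simp: N_def)
    then show ?thesis by (simp add: open_Int open_Collect_less continuous_on_dist)
  qed
  have rho_N: "\<sigma> n x = \<rho> x" if x: "x \<in> N n" for n x
  proof (cases "dist (y n) x < e n / 2")
    case True
    then show ?thesis using rho_in by simp
  next
    case False
    have "dist (y m) x \<ge> e m / 2" for m
    proof (rule ccontr)
      assume m: "\<not> ?thesis"
      then have *: "e m < dist p x" "dist p x < 2 * e m" using shell[of m x] by auto
      consider "m = n" | "m > n" | "m < n" by linarith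
      then show False
      proof cases
        case 1
        then show False using False m by simp
      next
        case 2
        then have "e m \<le> e (Suc n)" by (intro e_mono) auto
        then show False using * x by (auto simp: N_def)
      next
        case 3
        then have "e (n - 1) \<le> e m" by (intro e_mono) auto
        then show False using * x 3 by (auto simp: N_def)
      qed
    qed
    moreover have "x \<noteq> p" using x e_pos[of "Suc n"] by (auto simp: N_def)
    ultimately show ?thesis using rho_out[of x] \<sigma>(2)[of n x] by simp
  qed
  have cover: "\<exists>n. x \<in> N n \<and> e n \<le> dist p x" if "x \<noteq> p" for x
  proof -
    \<comment> \<open>Minimality gives the outer bound of \<open>N n\<close>, and
      \<open>2 * e (Suc n) < e n\<close> the inner one. The extra conclusion
      \<open>e n \<le> dist p x\<close> later forces large indices near \<open>p\<close>.\<close>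
    define n where "n = (LEAST n. e n \<le> dist p x)"
    have "\<exists>n. e n \<le> dist p x" using e_lim[of "dist p x"] that by (auto intro: less_imp_le)
    then have n: "e n \<le> dist p x" unfolding n_def by (rule LeastI_ex)
    have "dist p x < e (n - 1)" if "n \<noteq> 0"
      using not_less_Least[of "n - 1" "\<lambda>n. e n \<le> dist p x"] that unfolding n_def by force
    then have "x \<in> N n" using n e_Suc[of n] by (auto simp: N_def)
    then show ?thesis using n by blast
  qed
  show thesis
  proof (rule that[of \<rho>])
    show "\<rho> p = v" by (simp add: \<rho>_def)
  next
    fix x assume x: "dist p x \<ge> r"
    then have "x \<noteq> p" using r by auto
    moreover have "dist (y n) x \<ge> e n / 2" for n
    proof (rule ccontr)
      assume "\<not> ?thesis"
      then have "dist p x < 2 * e n" using shell[of n x] by simp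
      then show False using x e_mono[of 0 n] y(2)[of n] r unfolding e_def by simp
    qed
    ultimately show "\<rho> x = \<beta> x" by (intro rho_out)
  next
    fix x assume "x \<noteq> p"
    then obtain m where "x \<in> N m" using cover by blast
    then have "G m (\<sigma> m) \<and> open (N m) \<and> x \<in> N m \<and> (\<forall>y\<in>N m. \<sigma> m y = \<rho> y)"
      using \<sigma>(1) open_N rho_N by simp
    then show "\<exists>m \<sigma> N. G m \<sigma> \<and> open N \<and> x \<in> N \<and> (\<forall>y\<in>N. \<sigma> y = \<rho> y)"
      by (intro exI)
  next
    fix n
    have "\<exists>m\<ge>n. \<exists>\<sigma> N. G m \<sigma> \<and> open N \<and> x \<in> N \<and> (\<forall>y\<in>N. \<sigma> y = \<rho> y)"
      if x: "x \<noteq> p" "dist p x < e n" for x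
    proof -
      obtain m where m: "x \<in> N m" "e m \<le> dist p x" using cover[OF x(1)] by blast
      have "m \<ge> n"
      proof (rule ccontr)
        assume "\<not> ?thesis"
        then have "e n \<le> e m" by (intro e_mono) simp
        then show False using x(2) m(2) by simp
      qed
      then have "m \<ge> n \<and> G m (\<sigma> m) \<and> open (N m) \<and> x \<in> N m \<and> (\<forall>y\<in>N m. \<sigma> m y = \<rho> y)"
        using m(1) \<sigma>(1) open_N rho_N by simp
      then show ?thesis by blast
    qed
    then show "\<exists>e>0. \<forall>x. x \<noteq> p \<longrightarrow> dist p x < e \<longrightarrow>
      (\<exists>m\<ge>n. \<exists>\<sigma> N. G m \<sigma> \<and> open N \<and> x \<in> N \<and> (\<forall>y\<in>N. \<sigma> y = \<rho> y))"
      using e_pos[of n] by blast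
  next
    fix \<epsilon> :: real assume "\<epsilon> > 0"
    then obtain M where M: "e M < \<epsilon>/2" using e_lim[of "\<epsilon>/2"] by auto
    have "\<exists>x. x \<noteq> p \<and> dist p x < \<epsilon> \<and> A m (\<rho> x)" if "m \<ge> M" for m
    proof -
      obtain x where x: "dist (y m) x < e m / 2" "A m (\<sigma> m x)" using \<sigma>(3) by blast
      have "dist p x < \<epsilon>" "dist p x > 0" using shell[OF x(1)] e_mono[OF that] M e_pos[of m] by linarith+
      then show ?thesis using x rho_in[OF x(1)] by (intro exI[of _ x]) auto
    qed
    then show "\<exists>M. \<forall>m\<ge>M. \<exists>x. x \<noteq> p \<and> dist p x < \<epsilon> \<and> A m (\<rho> x)" by blast
  qed
qed

section \<open>Gluing labellings and passing between backgrounds\<close>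

context typed_frame begin

lemma labelling_mono: "labelling T \<rho> \<Longrightarrow> T \<subseteq> T' \<Longrightarrow> labelling T' \<rho>"
  by (auto simp: labelling_def)

text \<open>Both labellings equal \<open>\<beta>\<close> on the annulus between \<open>r'\<close>
  and \<open>r\<close>, so around each point the patched map coincides with one of them, and
  goodness is local.\<close>

lemma labelling_patch:
  fixes \<rho> \<sigma> \<beta> :: "'x::metric_space \<Rightarrow> 'w"
  assumes "labelling T \<rho>" "labelling T \<sigma>" "r' < r"
    "\<And>x. dist y x < r \<Longrightarrow> \<rho> x = \<beta> x" "\<And>x. dist y x \<ge> r' \<Longrightarrow> \<sigma> x = \<beta> x"
  shows "labelling T (\<lambda>x. if dist y x < r' then \<sigma> x else \<rho> x)"
proof -
  let ?\<tau> = "\<lambda>x. if dist y x < r' then \<sigma> x else \<rho> x"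
  have "good ?\<tau> x" for x
  proof (cases "dist y x < r")
    case True
    have "?\<tau> z = \<sigma> z" if "dist y z < r" for z using assms that by auto
    then show ?thesis
      using good_cong[of "ball y r" x \<sigma> ?\<tau>] assms(2) True by (simp add: labelling_def)
  next
    case False
    then show ?thesis
      using good_cong[of "- cball y r'" x \<rho> ?\<tau>] assms(1,3)
      by (simp add: labelling_def open_Compl)
  qed
  then show ?thesis using assms by (auto simp: labelling_def)
qed

end

text \<open>The assumption \<open>connected\<close> is the frame form of \<open>G\<^sub>1\<close>.
  One background \<open>B k\<close> is fixed for each collection so that constructions made in it
  can be glued; as a parameter, it can be chosen to be shared by frames for different finite sets of
  formulas.\<close>

locale coloured_frame = typed_frame W R t
  for W :: "'w set" and R :: "'w \<Rightarrow> 'w set" and t :: "'w \<Rightarrow> 't" +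
  fixes B :: "'t set \<Rightarrow> 'x::{metric_space, perfect_space} \<Rightarrow> 'w"
  assumes connected: "a \<in> W \<Longrightarrow> (\<And>b. b \<in> R a \<Longrightarrow> Fin b \<subseteq> V \<or> Fin b \<inter> V = {}) \<Longrightarrow>
      Fin a \<subseteq> V \<or> Fin a \<inter> V = {}"
    and background_B: "a \<in> W \<Longrightarrow> k \<in> Fin a \<Longrightarrow> background k (B k)"
begin

text \<open>A world counts as reflexive when it sees its own type, whether or not it is a successor
  of itself.\<close>

lemma S_eq_reflexive: "b \<in> R a \<Longrightarrow> S b = S a \<Longrightarrow> t b \<in> S b"
  using t_in_S by auto

text \<open>An irreflexive successor of \<open>a\<close> sees strictly fewer types than
  \<open>a\<close>, since \<open>a\<close> sees its type. Induction on the number of seen types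
  therefore removes the irreflexive steps.\<close>

lemma connected_reflexive:
  assumes "a \<in> W" "\<And>b. b \<in> R a \<Longrightarrow> t b \<in> S b \<Longrightarrow> Fin b \<subseteq> V \<or> Fin b \<inter> V = {}"
  shows "Fin a \<subseteq> V \<or> Fin a \<inter> V = {}"
  using assms
proof (induction "card (S a)" arbitrary: a rule: less_induct)
  case less
  show ?case
  proof (rule connected[OF less.prems(1)])
    fix b assume b: "b \<in> R a"
    show "Fin b \<subseteq> V \<or> Fin b \<inter> V = {}"
    proof (cases "t b \<in> S b")
      case False
      have bW: "b \<in> W" using b R_W less.prems by blast
      have "S b \<subset> S a" using S_mono[OF less.prems(1) b] S_eq_reflexive[OF b] False by auto
      then have "card (S b) < card (S a)" using finite_S less.prems(1) by (simp add: psubset_card_mono)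
      then show ?thesis
        by (rule less.hyps[OF _ bW]) (use less.prems R_trans[OF less.prems(1) b] in blast)
    qed (use less.prems b in blast)
  qed
qed

text \<open>The type of \<open>b\<close> is inserted because an irreflexive \<open>b\<close> does
  not see it.\<close>

definition pointed :: "'w \<Rightarrow> 't set \<Rightarrow> bool" where
  "pointed b k \<longleftrightarrow> (\<forall>y r. r > 0 \<longrightarrow> (\<exists>\<rho>::'x \<Rightarrow> 'w. labelling (insert (t b) (S b)) \<rho> \<and> \<rho> y = b \<and>
     (\<forall>x. dist y x \<ge> r \<longrightarrow> \<rho> x = B k x)))"

definition realizable :: "'w \<Rightarrow> 't \<Rightarrow> 't set \<Rightarrow> bool" where
  "realizable a s k \<longleftrightarrow> (\<forall>y r. r > 0 \<longrightarrow> (\<exists>\<rho>::'x \<Rightarrow> 'w. labelling (S a) \<rho> \<and>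
     (\<forall>x. dist y x \<ge> r \<longrightarrow> \<rho> x = B k x) \<and> (\<exists>x. dist y x < r \<and> t (\<rho> x) = s)))"

lemma pointed_labelling:
  assumes "a \<in> W" "b \<in> R a" "labelling (insert (t b) (S b)) \<rho>"
  shows "labelling (S a) \<rho>"
  using labelling_mono[OF assms(3), of "S a"] S_mono[OF assms(1,2)] t_in_S[OF assms(2)] by blast

lemma pointed_reflexive:
  assumes a: "a \<in> W" "t a \<in> S a" and k: "k \<in> Fin a"
    and less: "\<And>b k. b \<in> R a \<Longrightarrow> S b \<noteq> S a \<Longrightarrow> k \<in> Fin b \<Longrightarrow> pointed b k"
  shows "pointed a k"
  unfolding pointed_def
proof (intro allI impI)
  fix y :: 'x and r :: real assume r: "r > 0"
  \<comment> \<open>The background is kept outside, and \<open>y\<close> is an isolated point of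
    \<open>K\<close>. As the space is perfect, \<open>y\<close> is not interior to \<open>K\<close>,
    so the filling puts the label \<open>a\<close> there.\<close>
  define K where "K = {x. dist y x \<ge> r/2} \<union> {y}"
  have K: "closed K" unfolding K_def
    by (intro closed_Un closed_Collect_le continuous_intros) auto
  have "\<exists>\<rho>::'x \<Rightarrow> 'w. labelling (S a) \<rho> \<and> \<rho> y = b" if b: "b \<in> R a" "S b \<noteq> S a" for b y
  proof -
    have "b \<in> W" using b R_W a by blast
    then obtain k where "k \<in> Fin b" using Fin_nonempty by blast
    then show ?thesis
      using less[OF b, of k] pointed_labelling[OF a(1) b(1)] zero_less_one unfolding pointed_def by blast
  qed
  moreover have "B k x \<in> W \<and> good (B k) x \<and> t (B k x) \<in> S a" for x
    using backgroundD(1,3,4)[OF background_B[OF a(1) k]] Fin_subset_S[OF a(1) k] by blast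
  ultimately obtain \<rho> where \<rho>: "labelling (S a) \<rho>" "\<And>x. x \<in> interior K \<Longrightarrow> \<rho> x = B k x"
    "\<And>x. x \<in> K \<Longrightarrow> x \<notin> interior K \<Longrightarrow> \<rho> x = a"
    using reflexive_fill[OF a K, of "B k"] by blast
  have "y \<notin> interior K"
  proof
    assume "y \<in> interior K"
    then obtain e where e: "e > 0" "ball y e \<subseteq> K" by (auto simp: mem_interior)
    obtain z where "z \<noteq> y" "dist z y < min e (r/2)"
      using perfect_choose_dist[of "min e (r/2)" y] e r by auto
    then have "z \<in> ball y e" "z \<notin> K" by (auto simp: K_def dist_commute)
    then show False using e by blast
  qed
  then have "\<rho> y = a" using \<rho>(3) by (simp add: K_def)
  moreover have "\<rho> x = B k x" if "dist y x \<ge> r" for x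
  proof (rule \<rho>(2), rule interiorI)
    show "open {x. r/2 < dist y x}" by (intro open_Collect_less continuous_intros)
    show "x \<in> {x. r/2 < dist y x}" using that r by simp
    show "{x. r/2 < dist y x} \<subseteq> K" by (auto simp: K_def)
  qed
  ultimately show "\<exists>\<rho>::'x \<Rightarrow> 'w. labelling (insert (t a) (S a)) \<rho> \<and> \<rho> y = a \<and>
      (\<forall>x. dist y x \<ge> r \<longrightarrow> \<rho> x = B k x)"
    using labelling_mono[OF \<rho>(1)] by blast
qed

text \<open>A ball with background \<open>B k'\<close> is put into the background \<open>B k\<close>, with the boundary filled
  by the reflexive world \<open>b\<close> that sees both.\<close>

lemma realizable_transfer:
  assumes a: "a \<in> W" and b: "b \<in> R a" "t b \<in> S b" and k: "k \<in> Fin b" "k' \<in> Fin b"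
    and k': "realizable a s k'"
    and pt: "\<And>b k. b \<in> R a \<Longrightarrow> k \<in> Fin b \<Longrightarrow> pointed b k"
  shows "realizable a s k"
  unfolding realizable_def
proof (intro allI impI)
  fix y :: 'x and r :: real assume r: "r > 0"
  have bW: "b \<in> W" using b R_W a by blast
  \<comment> \<open>Outside lies \<open>B k\<close>, inside \<open>B k'\<close>; the filling acts in
    the open shell between the radii \<open>r/4\<close> and \<open>r/2\<close> and on the boundary
    of \<open>K\<close>.\<close>
  define K where "K = {x. dist y x \<ge> r/2} \<union> {x. dist y x \<le> r/4}"
  define \<eta> where "\<eta> x = (if dist y x \<ge> r/2 then B k x else B k' x)" for x
  have K: "closed K" unfolding K_def
    by (intro closed_Un closed_Collect_le continuous_intros)
  have types: "\<eta> x \<in> W \<and> t (\<eta> x) \<in> S b" for x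
    using backgroundD(1,3)[OF background_B[OF bW k(1)], of x] Fin_subset_S[OF bW k(1)]
      backgroundD(1,3)[OF background_B[OF bW k(2)], of x] Fin_subset_S[OF bW k(2)]
    by (auto simp: \<eta>_def)
  have good_\<eta>: "good \<eta> x" if x: "x \<in> interior K" for x
  proof (cases "dist y x \<ge> r/2")
    case True
    have o: "open (interior K \<inter> {x. r/4 < dist y x})"
      by (intro open_Int open_interior open_Collect_less continuous_intros)
    have "B k z = \<eta> z" if "z \<in> interior K \<inter> {x. r/4 < dist y x}" for z
      using that interior_subset[of K] by (auto simp: K_def \<eta>_def)
    then show ?thesis
      using good_cong[OF o, of x "B k" \<eta>] backgroundD(4)[OF background_B[OF bW k(1)]] True x r by auto
  next
    case False
    have "B k' z = \<eta> z" if "z \<in> ball y (r/2)" for z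
      using that by (auto simp: \<eta>_def)
    then show ?thesis
      using good_cong[of "ball y (r/2)" x "B k'" \<eta>] backgroundD(4)[OF background_B[OF bW k(2)]] False by auto
  qed
  have small: "\<exists>\<rho>::'x \<Rightarrow> 'w. labelling (S b) \<rho> \<and> \<rho> y = c" if c: "c \<in> R b" "S c \<noteq> S b" for c y
  proof -
    have "c \<in> W" "c \<in> R a" using c R_W bW R_trans[OF a b(1)] by auto
    then obtain k where "k \<in> Fin c" using Fin_nonempty by blast
    then show ?thesis
      using pt[OF \<open>c \<in> R a\<close>, of k] pointed_labelling[OF bW c(1)] zero_less_one unfolding pointed_def by blast
  qed
  obtain \<rho> where \<rho>: "labelling (S b) \<rho>" "\<And>x. x \<in> interior K \<Longrightarrow> \<rho> x = \<eta> x"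
  proof (rule reflexive_fill[OF bW b(2) K, of \<eta>])
    show "\<eta> x \<in> W \<and> good \<eta> x \<and> t (\<eta> x) \<in> S b" if "x \<in> interior K" for x
      using types[of x] good_\<eta>[OF that] by simp
    show "\<exists>\<rho>::'x \<Rightarrow> 'w. labelling (S b) \<rho> \<and> \<rho> y = c" if "c \<in> R b" "S c \<noteq> S b" for c y
      using small[OF that] .
  qed (rule that)
  have in_K: "x \<in> interior K" if "dist y x < r/4" for x
    by (rule interiorI[of "ball y (r/4)"]) (use that in \<open>auto simp: K_def\<close>)
  have out_K: "x \<in> interior K" if "dist y x > r/2" for x
  proof (rule interiorI)
    show "open {x. r/2 < dist y x}" by (intro open_Collect_less continuous_intros)
  qed (use that in \<open>auto simp: K_def\<close>)
  have \<rho>_in: "\<rho> x = B k' x" if "dist y x < r/4" for x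
    using \<rho>(2)[OF in_K[OF that]] that r by (simp add: \<eta>_def)
  \<comment> \<open>Radius \<open>r/8\<close> keeps the occurrence of \<open>s\<close> well inside
    the ball of radius \<open>r/4\<close> on which \<open>\<rho>\<close> is still
    \<open>B k'\<close>, so the two can be patched.\<close>
  obtain \<sigma> :: "'x \<Rightarrow> 'w" where \<sigma>: "labelling (S a) \<sigma>" "\<And>x. dist y x \<ge> r/8 \<Longrightarrow> \<sigma> x = B k' x"
    "\<exists>x. dist y x < r/8 \<and> t (\<sigma> x) = s"
    using k' r unfolding realizable_def by (metis zero_less_divide_iff zero_less_numeral)
  let ?\<tau> = "\<lambda>x. if dist y x < r/8 then \<sigma> x else \<rho> x"
  have "labelling (S a) ?\<tau>"
    by (rule labelling_patch[OF labelling_mono[OF \<rho>(1) S_mono[OF a b(1)]] \<sigma>(1), of _ "r/4" _ "B k'"])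
      (use r \<rho>_in \<sigma>(2) in auto)
  moreover have "?\<tau> x = B k x" if "dist y x \<ge> r" for x
    using \<rho>(2)[OF out_K, of x] that r by (auto simp: \<eta>_def)
  moreover have "\<exists>x. dist y x < r \<and> t (?\<tau> x) = s"
    using \<sigma>(3) r by force
  ultimately show "\<exists>\<rho>::'x \<Rightarrow> 'w. labelling (S a) \<rho> \<and>
     (\<forall>x. dist y x \<ge> r \<longrightarrow> \<rho> x = B k x) \<and> (\<exists>x. dist y x < r \<and> t (\<rho> x) = s)"
    by (intro exI[of _ ?\<tau>]) blast
qed

text \<open>The collections from whose backgrounds \<open>s\<close> is realizable are closed under
  reflexive links, by \<open>realizable_transfer\<close>. One such collection exists: any
  \<open>k'\<close> seen by a successor \<open>b\<close> of type \<open>s\<close>, which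
  \<open>pointed\<close> places into \<open>B k'\<close>. Connectedness then yields all of
  \<open>Fin a\<close>.\<close>

lemma realizable_all:
  assumes a: "a \<in> W" and k: "k \<in> Fin a" and s: "s \<in> S a"
    and pt: "\<And>b k. b \<in> R a \<Longrightarrow> k \<in> Fin b \<Longrightarrow> pointed b k"
  shows "realizable a s k"
proof -
  let ?V = "{k. realizable a s k}"
  have "Fin a \<subseteq> ?V \<or> Fin a \<inter> ?V = {}"
  proof (rule connected_reflexive[OF a])
    fix b assume b: "b \<in> R a" "t b \<in> S b"
    show "Fin b \<subseteq> ?V \<or> Fin b \<inter> ?V = {}"
      using realizable_transfer[OF a b _ _ _ pt] by blast
  qed
  moreover obtain b where b: "b \<in> R a" "t b = s" using s by (auto simp: S_def)
  have "b \<in> W" using b R_W a by blast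
  then obtain k' where k': "k' \<in> Fin b" using Fin_nonempty by blast
  have "realizable a s k'"
    unfolding realizable_def
  proof (intro allI impI)
    fix y :: 'x and r :: real assume r: "r > 0"
    then obtain \<rho> :: "'x \<Rightarrow> 'w" where "labelling (insert (t b) (S b)) \<rho>" "\<rho> y = b"
      "\<forall>x. dist y x \<ge> r \<longrightarrow> \<rho> x = B k' x"
      using pt[OF b(1) k'] unfolding pointed_def by blast
    then show "\<exists>\<rho>::'x \<Rightarrow> 'w. labelling (S a) \<rho> \<and>
     (\<forall>x. dist y x \<ge> r \<longrightarrow> \<rho> x = B k' x) \<and> (\<exists>x. dist y x < r \<and> t (\<rho> x) = s)"
      using pointed_labelling[OF a b(1)] b(2) r by (metis dist_self)
  qed
  then have "Fin a \<inter> ?V \<noteq> {}" using k' Fin_mono[OF a b(1)] by blast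
  ultimately show ?thesis using k by blast
qed

text \<open>The label \<open>a\<close> at \<open>y\<close> is surrounded by shells that realize the
  types \<open>t (w m)\<close> in turn; every type of \<open>S a\<close> recurs in \<open>w\<close>,
  so it accumulates at \<open>y\<close>.\<close>

lemma pointed_of_realizable:
  assumes a: "a \<in> W" and real: "\<And>s. s \<in> S a \<Longrightarrow> realizable a s k"
  shows "pointed a k"
  unfolding pointed_def
proof (intro allI impI)
  fix y :: 'x and r :: real assume r: "r > 0"
  obtain w :: "nat \<Rightarrow> 'w" where w: "\<And>m. w m \<in> R a" "\<And>s M. s \<in> S a \<Longrightarrow> \<exists>m\<ge>M. t (w m) = s"
    using ex_visiting_sequence[OF a] by metis
  have pert: "\<exists>\<sigma>. labelling (S a) \<sigma> \<and> (\<forall>x. dist y x \<ge> e \<longrightarrow> \<sigma> x = B k x) \<and>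
      (\<exists>x. dist y x < e \<and> t (\<sigma> x) = t (w n))" if "e > 0" for n y e
    using real[OF t_in_S[OF w(1)]] that unfolding realizable_def by blast
  obtain \<rho> where \<rho>: "\<rho> y = a" "\<And>x. dist y x \<ge> r \<Longrightarrow> \<rho> x = B k x"
    "\<And>x. x \<noteq> y \<Longrightarrow> \<exists>(m::nat) \<sigma> N. labelling (S a) \<sigma> \<and> open N \<and> x \<in> N \<and> (\<forall>y\<in>N. \<sigma> y = \<rho> y)"
    "\<And>e. e > 0 \<Longrightarrow> \<exists>M. \<forall>m\<ge>M. \<exists>x. x \<noteq> y \<and> dist y x < e \<and> t (\<rho> x) = t (w m)"
    by (rule perturb_near_point[where G = "\<lambda>_. labelling (S a)" and A = "\<lambda>m v. t v = t (w m)"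
          and \<beta> = "B k" and r = r and p = y and v = a, OF r pert]) blast+
  have other: "\<rho> x \<in> W \<and> good \<rho> x \<and> t (\<rho> x) \<in> S a" if x: "x \<noteq> y" for x
  proof -
    obtain \<sigma> N where *: "labelling (S a) \<sigma>" "open N" "x \<in> N" "\<And>y. y \<in> N \<Longrightarrow> \<sigma> y = \<rho> y"
      using \<rho>(3)[OF x] by blast
    then have "good \<rho> x" using good_cong[of N x \<sigma> \<rho>] unfolding labelling_def by blast
    then show ?thesis using * unfolding labelling_def by metis
  qed
  have "\<exists>x. x \<noteq> y \<and> dist y x < e \<and> t (\<rho> x) = s" if "s \<in> S a" "e > 0" for s e
    using \<rho>(4)[OF that(2)] w(2)[OF that(1)] by metis
  then have "good \<rho> y" unfolding good_def \<rho>(1) using other zero_less_one by metis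
  then have "labelling (insert (t a) (S a)) \<rho>" unfolding labelling_def using other \<rho>(1) a by (metis insert_iff)
  then show "\<exists>\<rho>::'x \<Rightarrow> 'w. labelling (insert (t a) (S a)) \<rho> \<and> \<rho> y = a \<and>
      (\<forall>x. dist y x \<ge> r \<longrightarrow> \<rho> x = B k x)"
    using \<rho> by blast
qed

text \<open>A successor that sees the same types as \<open>a\<close> is reflexive, so it is smaller than \<open>a\<close> in the
  measure below if \<open>a\<close> is irreflexive; it is not needed if \<open>a\<close> is reflexive.\<close>

lemma pointed_all:
  assumes "a \<in> W" "k \<in> Fin a"
  shows "pointed a k"
  using assms
\<comment> \<open>The factor 2 lets the loss of one seen type outweigh a change from reflexive to
  irreflexive.\<close>
proof (induction "2 * card (S a) + (if t a \<in> S a then 0 else 1)" arbitrary: a k rule: less_induct)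
  case less
  have smaller: "pointed b k" if b: "b \<in> R a" "k \<in> Fin b" "S b \<noteq> S a \<or> t a \<notin> S a" for b k
  proof (rule less.hyps)
    show "b \<in> W" using b R_W less.prems by blast
    have fin: "finite (S a)" using finite_S less.prems by blast
    have sub: "S b \<subseteq> S a" using S_mono less.prems b by blast
    show "2 * card (S b) + (if t b \<in> S b then 0 else 1) < 2 * card (S a) + (if t a \<in> S a then 0 else 1)"
    proof (cases "S b = S a")
      case True
      then show ?thesis using b S_eq_reflexive by auto
    next
      case False
      then have "card (S b) < card (S a)" using fin sub by (simp add: psubset_card_mono psubset_eq)
      then show ?thesis by auto
    qed
  qed (use b in blast)
  show ?case
  proof (cases "t a \<in> S a")
    case True
    then show ?thesis using pointed_reflexive less.prems smaller by blast
  next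
    case False
    then show ?thesis
      using pointed_of_realizable realizable_all less.prems smaller by blast
  qed
qed

theorem realizable_everywhere:
  assumes "a \<in> W" "k \<in> Fin a" "s \<in> S a"
  shows "realizable a s k"
  using realizable_all[OF assms] pointed_all R_W[OF assms(1)] by blast

end


section \<open>Completeness and soundness\<close>

primrec subs :: "'v fm \<Rightarrow> 'v fm set" where
  "subs (Atom p) = {Atom p}"
| "subs \<^bold>\<top> = {\<^bold>\<top>}"
| "subs (\<^bold>\<not> \<phi>) = insert (\<^bold>\<not> \<phi>) (subs \<phi>)"
| "subs (\<phi> \<^bold>\<and> \<psi>) = insert (\<phi> \<^bold>\<and> \<psi>) (subs \<phi> \<union> subs \<psi>)"
| "subs (\<box> \<phi>) = insert (\<box> \<phi>) (subs \<phi>)"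

lemma finite_subs: "finite (subs \<phi>)"
  by (induction \<phi>) auto

lemma self_in_subs: "\<phi> \<in> subs \<phi>"
  by (cases \<phi>) auto

lemma subs_trans: "\<psi> \<in> subs \<phi> \<Longrightarrow> subs \<psi> \<subseteq> subs \<phi>"
  by (induction \<phi>) auto

abbreviation type_of :: "'v fm set \<Rightarrow> 'v fm set \<Rightarrow> 'v fm set" where
  "type_of \<Sigma> a \<equiv> a \<inter> \<Sigma>"

lemma typed_frame_mcs:
  assumes "finite \<Sigma>"
  shows "typed_frame {a. mcs a} Succ (type_of \<Sigma>)"
proof (rule typed_frame.intro)
  fix a :: "'a fm set" assume a: "a \<in> {a. mcs a}"
  show "Succ a \<subseteq> {a. mcs a}" using Succ_mcs by blast
  show "Succ a \<noteq> {}" using Succ_nonempty a by blast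
  show "Succ b \<subseteq> Succ a" if "b \<in> Succ a" for b using Succ_trans a that by blast
next
  have "type_of \<Sigma> ` {a. mcs a} \<subseteq> Pow \<Sigma>" by blast
  then show "finite (type_of \<Sigma> ` {a. mcs a})" by (rule finite_subset) (simp add: assms)
qed

lemma definable_type:
  assumes "finite \<Sigma>"
  shows "definable {a. type_of \<Sigma> a = s}"
proof -
  have "definable {a. (\<forall>\<phi>\<in>\<Sigma>. \<phi> \<in> a \<longleftrightarrow> \<phi> \<in> s) \<and> s \<subseteq> \<Sigma>}"
    by (intro definable_conj definable_Ball assms definable_iff definable_mem definable_const)
  moreover have "{a. (\<forall>\<phi>\<in>\<Sigma>. \<phi> \<in> a \<longleftrightarrow> \<phi> \<in> s) \<and> s \<subseteq> \<Sigma>} = {a. type_of \<Sigma> a = s}"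
    by blast
  ultimately show ?thesis by simp
qed

text \<open>There are only finitely many types over \<open>\<Sigma>\<close>, so lying inside
  \<open>V\<close> and lying outside \<open>V\<close> are definable properties of
  \<open>Fin b\<close>, for arbitrary \<open>V\<close>. They are preserved by successors because
  \<open>Fin\<close> shrinks, and they exclude each other because \<open>Fin\<close> is
  non-empty.\<close>

lemma mcs_connected:
  assumes fin: "finite \<Sigma>" and a: "mcs a"
    and V: "\<And>b. b \<in> Succ a \<Longrightarrow> typed_frame.Fin Succ (type_of \<Sigma>) b \<subseteq> V \<or>
      typed_frame.Fin Succ (type_of \<Sigma>) b \<inter> V = {}"
  shows "typed_frame.Fin Succ (type_of \<Sigma>) a \<subseteq> V \<or> typed_frame.Fin Succ (type_of \<Sigma>) a \<inter> V = {}"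
proof -
  interpret typed_frame "{a. mcs a}" Succ "type_of \<Sigma>" by (rule typed_frame_mcs[OF fin])
  let ?T = "Pow \<Sigma>"
  have finT: "finite ?T" "finite (Pow ?T)" using fin by auto
  have S_sub: "S b \<subseteq> ?T" for b by (auto simp: S_def)
  have def_S: "definable {b. S b = k}" for k
  proof -
    have "definable {b. (\<forall>s\<in>?T. (\<exists>c\<in>Succ b. type_of \<Sigma> c = s) \<longleftrightarrow> s \<in> k) \<and> k \<subseteq> ?T}"
      by (intro definable_conj definable_Ball finT definable_iff definable_ex_Succ
          definable_type fin definable_const)
    moreover have "(\<exists>c\<in>Succ b. type_of \<Sigma> c = s) \<longleftrightarrow> s \<in> S b" for b s
      by (auto simp: S_def)
    moreover have "{b. (\<forall>s\<in>?T. s \<in> S b \<longleftrightarrow> s \<in> k) \<and> k \<subseteq> ?T} = {b. S b = k}"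
      using S_sub by blast
    ultimately show ?thesis by simp
  qed
  have def_Fin: "definable {b. k \<in> Fin b}" for k
  proof -
    have "definable {b. \<exists>c\<in>Succ b. S c = k \<and> (\<forall>d\<in>Succ c. S d = k)}"
      by (intro definable_ex_Succ definable_conj definable_all_Succ def_S)
    moreover have "{b. \<exists>c\<in>Succ b. S c = k \<and> (\<forall>d\<in>Succ c. S d = k)} = {b. k \<in> Fin b}"
      by (auto simp: Fin_def final_def)
    ultimately show ?thesis by simp
  qed
  have Fin_sub: "Fin b \<subseteq> Pow ?T" for b using S_sub by (auto simp: Fin_def)
  have "definable {b. \<forall>k\<in>Pow ?T. k \<in> Fin b \<longrightarrow> k \<in> V}" "definable {b. \<forall>k\<in>Pow ?T. k \<in> Fin b \<longrightarrow> k \<notin> V}"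
    unfolding imp_conv_disj
    by (intro definable_Ball finT definable_disj definable_Not def_Fin definable_const)+
  moreover have "(\<forall>k\<in>Pow ?T. k \<in> Fin b \<longrightarrow> k \<in> V) \<longleftrightarrow> Fin b \<subseteq> V"
    "(\<forall>k\<in>Pow ?T. k \<in> Fin b \<longrightarrow> k \<notin> V) \<longleftrightarrow> Fin b \<inter> V = {}" for b
    using Fin_sub[of b] by blast+
  ultimately have d: "definable {b. Fin b \<subseteq> V}" "definable {b. Fin b \<inter> V = {}}" by simp_all
  have "(\<forall>b\<in>Succ a. Fin b \<subseteq> V) \<or> (\<forall>b\<in>Succ a. Fin b \<inter> V = {})"
  proof (rule Succ_definably_connected[OF a d])
    fix b assume b: "b \<in> Succ a"
    then have bW: "b \<in> {a. mcs a}" using Succ_mcs by blast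
    show "(Fin b \<subseteq> V \<longrightarrow> Fin c \<subseteq> V) \<and> (Fin b \<inter> V = {} \<longrightarrow> Fin c \<inter> V = {})" if "c \<in> Succ b" for c
      using Fin_mono[OF bW that] by blast
    show "Fin b \<subseteq> V \<longleftrightarrow> \<not> Fin b \<inter> V = {}"
      using V[OF b] Fin_nonempty[OF bW] by blast
  qed
  then show ?thesis using Fin_seen_above[of a] a by blast
qed

section \<open>From labellings to truth\<close>

lemma truth_lemma:
  fixes \<rho> :: "'x::metric_space \<Rightarrow> 'v fm set"
  assumes \<Sigma>: "finite \<Sigma>" "\<And>\<phi>. \<phi> \<in> \<Sigma> \<Longrightarrow> subs \<phi> \<subseteq> \<Sigma>" and N: "open N"
    and \<rho>: "\<And>x. x \<in> N \<Longrightarrow> mcs (\<rho> x) \<and> typed_frame.good Succ (type_of \<Sigma>) \<rho> x"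
    and \<phi>: "\<phi> \<in> \<Sigma>" and x: "x \<in> N"
  shows "truth (\<lambda>p. {x. Atom p \<in> \<rho> x}) x \<phi> \<longleftrightarrow> \<phi> \<in> \<rho> x"
proof -
  interpret typed_frame "{a. mcs a}" Succ "type_of \<Sigma>" by (rule typed_frame_mcs[OF \<Sigma>(1)])
  show ?thesis using \<phi> x
  proof (induction \<phi> arbitrary: x)
    case (Box \<phi>)
    have \<phi>: "\<phi> \<in> \<Sigma>" using \<Sigma>(2)[OF Box.prems(1)] self_in_subs by auto
    have m: "mcs (\<rho> x)" and g: "good \<rho> x" using \<rho>[OF Box.prems(2)] by auto
    have S: "\<phi> \<in> b \<longleftrightarrow> \<phi> \<in> type_of \<Sigma> b" for b using \<phi> by simp
    have box: "\<box> \<phi> \<in> \<rho> x \<longleftrightarrow> (\<forall>s\<in>S (\<rho> x). \<phi> \<in> s)"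
      unfolding mcs_Box[OF m] S_def using \<phi> by auto
    obtain d where d: "d > 0" "ball x d \<subseteq> N" using N Box.prems(2) open_contains_ball by blast
    obtain e where e: "e > 0" "\<forall>y. y \<noteq> x \<longrightarrow> dist x y < e \<longrightarrow> type_of \<Sigma> (\<rho> y) \<in> S (\<rho> x)"
      using g unfolding good_def by blast
    show ?case
    proof
      assume b: "\<box> \<phi> \<in> \<rho> x"
      have "truth (\<lambda>p. {x. Atom p \<in> \<rho> x}) y \<phi>" if "y \<in> ball x (min d e) - {x}" for y
      proof -
        have "y \<in> N" "type_of \<Sigma> (\<rho> y) \<in> S (\<rho> x)" using that d e by auto
        then show ?thesis using Box.IH[OF \<phi>] b box by auto
      qed
      moreover have "open (ball x (min d e))" "x \<in> ball x (min d e)" using d e by auto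
      ultimately show "truth (\<lambda>p. {x. Atom p \<in> \<rho> x}) x (\<box> \<phi>)"
        unfolding truth.simps by blast
    next
      assume "truth (\<lambda>p. {x. Atom p \<in> \<rho> x}) x (\<box> \<phi>)"
      then obtain U where U: "open U" "x \<in> U" "\<forall>y\<in>U - {x}. truth (\<lambda>p. {x. Atom p \<in> \<rho> x}) y \<phi>"
        by auto
      then obtain e' where e': "e' > 0" "ball x e' \<subseteq> U" using open_contains_ball by blast
      have "\<phi> \<in> s" if s: "s \<in> S (\<rho> x)" for s
      proof -
        have "min d e' > 0" using d e' by simp
        then obtain y where y: "y \<noteq> x" "dist x y < min d e'" "type_of \<Sigma> (\<rho> y) = s"
          using g s unfolding good_def by meson
        then have "y \<in> N" "y \<in> U" using d e' by auto
        then have "\<phi> \<in> \<rho> y" using Box.IH[OF \<phi>] U y by blast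
        then show ?thesis using y \<phi> by auto
      qed
      then show "\<box> \<phi> \<in> \<rho> x" using box by blast
    qed
  next
    case (Neg \<phi>)
    have "\<phi> \<in> \<Sigma>" using \<Sigma>(2)[OF Neg.prems(1)] self_in_subs by auto
    then show ?case using Neg \<rho>[OF Neg.prems(2)] by (simp add: mcs_Neg)
  next
    case (And \<phi> \<psi>)
    have "\<phi> \<in> \<Sigma>" "\<psi> \<in> \<Sigma>" using \<Sigma>(2)[OF And.prems(1)] self_in_subs by auto
    then show ?case using And \<rho>[OF And.prems(2)] by (simp add: mcs_And)
  next
    case Truth
    then show ?case using \<rho> by (auto simp: mcs_Truth)
  qed simp
qed

text \<open>Types over \<open>\<Sigma>'\<close> are restrictions of types over
  \<open>\<Sigma>\<close>, both for the labels nearby and for the successors.\<close>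

lemma good_type_mono:
  assumes "typed_frame.good Succ (type_of \<Sigma>) \<rho> x" "\<Sigma>' \<subseteq> \<Sigma>" "finite \<Sigma>"
  shows "typed_frame.good Succ (type_of \<Sigma>') \<rho> x"
proof -
  interpret f: typed_frame "{a. mcs a}" Succ "type_of \<Sigma>" by (rule typed_frame_mcs[OF assms(3)])
  interpret f': typed_frame "{a. mcs a}" Succ "type_of \<Sigma>'"
    by (rule typed_frame_mcs) (use assms finite_subset in blast)
  have S: "f'.S b = (\<lambda>s. s \<inter> \<Sigma>') ` f.S b" for b
    using assms(2) unfolding f.S_def f'.S_def image_image by (intro image_cong) auto
  have t: "type_of \<Sigma>' c = type_of \<Sigma> c \<inter> \<Sigma>'" for c using assms(2) by blast
  obtain e where e: "e > 0" "\<forall>y. y \<noteq> x \<longrightarrow> dist x y < e \<longrightarrow> type_of \<Sigma> (\<rho> y) \<in> f.S (\<rho> x)"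
    using assms(1) unfolding f.good_def by blast
  have "type_of \<Sigma>' (\<rho> y) \<in> f'.S (\<rho> x)" if "y \<noteq> x" "dist x y < e" for y
    unfolding S t[of "\<rho> y"] using e(2) that by (intro imageI) simp
  then have "\<exists>e>0. \<forall>y. y \<noteq> x \<longrightarrow> dist x y < e \<longrightarrow> type_of \<Sigma>' (\<rho> y) \<in> f'.S (\<rho> x)"
    using e(1) by auto
  moreover have "\<exists>y. y \<noteq> x \<and> dist x y < e \<and> type_of \<Sigma>' (\<rho> y) = s" if s: "s \<in> f'.S (\<rho> x)" "e > 0" for s e
  proof -
    obtain s' where s': "s' \<in> f.S (\<rho> x)" "s = s' \<inter> \<Sigma>'" using s unfolding S by blast
    then obtain y where "y \<noteq> x" "dist x y < e" "type_of \<Sigma> (\<rho> y) = s'"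
      using assms(1) s(2) unfolding f.good_def by meson
    then show ?thesis using s' t by metis
  qed
  ultimately show ?thesis unfolding f'.good_def by blast
qed

text \<open>The shell with index \<open>m\<close> around \<open>p\<close> is labelled faithfully for
  \<open>\<Sigma> m\<close>. For fixed \<open>n\<close>, all shells close enough to \<open>p\<close>
  are thus good for \<open>\<Sigma> n\<close>, and \<open>truth_lemma\<close> applies in a ball
  whose radius depends on \<open>n\<close>, while labelling and assignment do not.\<close>

lemma satisfiable_of_mcs:
  fixes a :: "'v fm set" and \<Sigma> :: "nat \<Rightarrow> 'v fm set" and p :: "'x::{metric_space, perfect_space}"
  assumes a: "mcs a" and fin: "\<And>n. finite (\<Sigma> n)" and \<Sigma>_Suc: "\<And>n. \<Sigma> n \<subseteq> \<Sigma> (Suc n)"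
    and \<Sigma>_subs: "\<And>n \<phi>. \<phi> \<in> \<Sigma> n \<Longrightarrow> subs \<phi> \<subseteq> \<Sigma> n"
  shows "\<exists>h :: 'v \<Rightarrow> 'x set. \<forall>n. \<forall>\<phi>\<in>\<Sigma> n. truth h p \<phi> \<longleftrightarrow> \<phi> \<in> a"
proof -
  interpret fr: typed_frame "{a. mcs a}" Succ "type_of (\<Sigma> n)" for n
    by (rule typed_frame_mcs[OF fin])
  have \<Sigma>_mono: "\<Sigma> m \<subseteq> \<Sigma> n" if "m \<le> n" for m n
    by (rule lift_Suc_mono_le[OF _ that]) (use \<Sigma>_Suc in blast)
  have "\<exists>b. \<forall>n. (mcs (b n) \<and> b n \<in> Succ a \<and> fr.final n (b n)) \<and> b (Suc n) \<in> Succ (b n)"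
  proof (rule dependent_nat_choice)
    show "\<exists>b. mcs b \<and> b \<in> Succ a \<and> fr.final 0 b" using fr.ex_final[of a 0] a Succ_mcs by blast
    fix b n assume b: "mcs b \<and> b \<in> Succ a \<and> fr.final n b"
    then obtain c where "c \<in> Succ b" "fr.final (Suc n) c" using fr.ex_final[of b "Suc n"] by blast
    then show "\<exists>c. (mcs c \<and> c \<in> Succ a \<and> fr.final (Suc n) c) \<and> c \<in> Succ b"
      using b Succ_mcs Succ_trans[OF a] by blast
  qed
  then obtain b where b: "\<And>n. mcs (b n)" "\<And>n. b n \<in> Succ a" "\<And>n. fr.final n (b n)"
    "\<And>n. b (Suc n) \<in> Succ (b n)"
    by metis
  obtain u where u: "mcs u" "\<And>n. u \<in> Succ (b n)"
  proof (rule Succ_chain_bound[of b, OF b(1) b(4)])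
  qed (rule that)
  have ua: "u \<in> Succ a" using u(2)[of 0] Succ_trans[OF a b(2)] by blast
  \<comment> \<open>Being a successor of every \<open>b n\<close>, the set \<open>u\<close> inherits
    finality for all \<open>\<Sigma> n\<close> simultaneously.\<close>
  have u_final: "fr.S n c = fr.S n u" if "c \<in> Succ u" for n c
  proof -
    have "c \<in> Succ (b n)" using Succ_trans[OF b(1) u(2)] that by blast
    then show ?thesis using b(3)[of n] u(2)[of n] unfolding fr.final_def by simp
  qed
  have uF: "fr.S n u \<in> fr.Fin n a" for n
    unfolding fr.Fin_def fr.final_def using ua u_final by blast
  obtain f :: "'x \<Rightarrow> nat" where f: "\<And>n x e. e > 0 \<Longrightarrow> \<exists>y. y \<noteq> x \<and> dist x y < e \<and> f y = n"
    using ex_dense_colouring by blast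
  have countable_cover: "\<exists>w::nat \<Rightarrow> 'v fm set. (\<forall>m. w m \<in> Succ c) \<and> (\<forall>n. \<forall>s\<in>fr.S n c. \<exists>m. type_of (\<Sigma> n) (w m) = s)"
    if c: "mcs c" for c
  proof -
    have "\<forall>n. \<exists>v::nat \<Rightarrow> 'v fm set. (\<forall>m. v m \<in> Succ c) \<and> (\<forall>s\<in>fr.S n c. \<exists>m. type_of (\<Sigma> n) (v m) = s)"
    proof
      fix n
      obtain v :: "nat \<Rightarrow> 'v fm set" where "\<And>m. v m \<in> Succ c" "\<And>s M. s \<in> fr.S n c \<Longrightarrow> \<exists>m\<ge>M. type_of (\<Sigma> n) (v m) = s"
        using fr.ex_visiting_sequence[of c n] c by blast
      then have "(\<forall>m. v m \<in> Succ c) \<and> (\<forall>s\<in>fr.S n c. \<exists>m. type_of (\<Sigma> n) (v m) = s)"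
        by blast
      then show "\<exists>v::nat \<Rightarrow> 'v fm set. (\<forall>m. v m \<in> Succ c) \<and> (\<forall>s\<in>fr.S n c. \<exists>m. type_of (\<Sigma> n) (v m) = s)"
        by blast
    qed
    then obtain v :: "nat \<Rightarrow> nat \<Rightarrow> 'v fm set" where v: "\<And>n m. v n m \<in> Succ c"
      "\<And>n s. s \<in> fr.S n c \<Longrightarrow> \<exists>m. type_of (\<Sigma> n) (v n m) = s"
      by metis
    \<comment> \<open>Pairing merges the sequences for the separate \<open>n\<close> into one
      sequence of successors that meets the types over every \<open>\<Sigma> n\<close>.\<close>
    let ?w = "\<lambda>m. case prod_decode m of (i, j) \<Rightarrow> v i j"
    have "\<exists>m. type_of (\<Sigma> n) (?w m) = s" if s: "s \<in> fr.S n c" for n s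
    proof -
      obtain m where "type_of (\<Sigma> n) (v n m) = s" using v(2)[OF s] by blast
      then show ?thesis by (intro exI[of _ "prod_encode (n, m)"]) simp
    qed
    moreover have "?w m \<in> Succ c" for m using v(1) by (simp split: prod.split)
    ultimately show ?thesis by (intro exI[of _ ?w]) simp
  qed
  obtain w :: "nat \<Rightarrow> 'v fm set" where
    "(\<forall>m. w m \<in> Succ u) \<and> (\<forall>n. \<forall>s\<in>fr.S n u. \<exists>m. type_of (\<Sigma> n) (w m) = s)"
    using countable_cover[OF u(1)] by (rule exE)
  then have w: "\<And>m. w m \<in> Succ u"
    "\<And>n s. s \<in> fr.S n u \<Longrightarrow> \<exists>m. type_of (\<Sigma> n) (w m) = s"
    by simp_all
  define \<beta> where "\<beta> x = w (f x)" for x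
  have \<beta>: "fr.background n (fr.S n u) \<beta>" for n
    unfolding fr.background_def
  proof (intro conjI allI ballI impI)
    fix x
    show "\<beta> x \<in> {a. mcs a}" using w(1) Succ_mcs by (auto simp: \<beta>_def)
    show "fr.S n (\<beta> x) = fr.S n u" using u_final w(1) by (auto simp: \<beta>_def)
    show "type_of (\<Sigma> n) (\<beta> x) \<in> fr.S n u" using w(1) unfolding \<beta>_def by (rule fr.t_in_S)
  next
    fix s x and e :: real assume "s \<in> fr.S n u" "e > 0"
    then show "\<exists>y. y \<noteq> x \<and> dist x y < e \<and> type_of (\<Sigma> n) (\<beta> y) = s"
      unfolding \<beta>_def using w(2) f by metis
  qed
  have "\<exists>\<delta>::'x \<Rightarrow> 'v fm set. fr.background n (fr.S n c) \<delta>" if "mcs c" "fr.final n c" for n c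
    using fr.ex_background[of c n] that by blast
  then have "\<forall>n k. \<exists>\<delta>::'x \<Rightarrow> 'v fm set. \<forall>c. mcs c \<longrightarrow> k \<in> fr.Fin n c \<longrightarrow> fr.background n k \<delta>"
    using Succ_mcs unfolding fr.Fin_def by blast
  then obtain \<delta> :: "nat \<Rightarrow> 'v fm set set \<Rightarrow> 'x \<Rightarrow> 'v fm set"
    where \<delta>: "\<And>n k c. mcs c \<Longrightarrow> k \<in> fr.Fin n c \<Longrightarrow> fr.background n k (\<delta> n k)"
    by metis
  \<comment> \<open>At every level the background for the collection of \<open>u\<close> is the same
    map \<open>\<beta>\<close>, so perturbations made at different levels fit into one
    labelling.\<close>
  define B where "B n k = (if k = fr.S n u then \<beta> else \<delta> n k)" for n k
  interpret cf: coloured_frame "{a. mcs a}" Succ "type_of (\<Sigma> n)" "B n" for n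
  proof
    show "fr.background n k (B n k)" if "c \<in> {a. mcs a}" "k \<in> fr.Fin n c" for c k
      using \<beta>[of n] \<delta>[of c k n] that unfolding B_def by auto
    show "fr.Fin n c \<subseteq> V \<or> fr.Fin n c \<inter> V = {}" if "c \<in> {a. mcs a}"
      "\<And>b. b \<in> Succ c \<Longrightarrow> fr.Fin n b \<subseteq> V \<or> fr.Fin n b \<inter> V = {}" for c V
      using mcs_connected[OF fin] that by blast
  qed
  obtain v :: "nat \<Rightarrow> 'v fm set" where
    "(\<forall>m. v m \<in> Succ a) \<and> (\<forall>n. \<forall>s\<in>fr.S n a. \<exists>m. type_of (\<Sigma> n) (v m) = s)"
    using countable_cover[OF a] by (rule exE)
  then have v: "\<And>m. v m \<in> Succ a"
    "\<And>n s. s \<in> fr.S n a \<Longrightarrow> \<exists>m. type_of (\<Sigma> n) (v m) = s"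
    by simp_all
  \<comment> \<open>Shell \<open>m\<close> realizes the type over \<open>\<Sigma> m\<close> of
    \<open>v (visit m)\<close>. Each \<open>v j\<close> returns in arbitrarily late shells, where
    agreement over \<open>\<Sigma> m\<close> includes agreement over any earlier
    \<open>\<Sigma> n\<close>.\<close>
  define A where "A m c \<longleftrightarrow> type_of (\<Sigma> m) c = type_of (\<Sigma> m) (v (visit m))" for m c
  have pert: "\<exists>\<sigma>. fr.labelling n (fr.S n a) \<sigma> \<and> (\<forall>x. dist y x \<ge> e \<longrightarrow> \<sigma> x = \<beta> x) \<and>
      (\<exists>x. dist y x < e \<and> A n (\<sigma> x))" if "e > 0" for n y e
  proof -
    have "cf.realizable n a (type_of (\<Sigma> n) (v (visit n))) (fr.S n u)"
      by (rule cf.realizable_everywhere) (use a uF v(1) fr.t_in_S in auto)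
    moreover have "B n (fr.S n u) = \<beta>" by (simp add: B_def)
    ultimately show ?thesis using that unfolding cf.realizable_def A_def by auto
  qed
  obtain \<rho> where \<rho>: "\<rho> p = a"
    "\<And>n. \<exists>e>0. \<forall>x. x \<noteq> p \<longrightarrow> dist p x < e \<longrightarrow>
      (\<exists>m\<ge>n. \<exists>\<sigma> N. fr.labelling m (fr.S m a) \<sigma> \<and> open N \<and> x \<in> N \<and> (\<forall>y\<in>N. \<sigma> y = \<rho> y))"
    "\<And>e. e > 0 \<Longrightarrow> \<exists>M. \<forall>m\<ge>M. \<exists>x. x \<noteq> p \<and> dist p x < e \<and> A m (\<rho> x)"
    by (rule perturb_near_point[where G = "\<lambda>m. fr.labelling m (fr.S m a)" and A = A
          and \<beta> = \<beta> and r = 1 and p = p and v = a, OF zero_less_one pert]) blast+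
  have near: "\<exists>e>0. \<forall>x\<in>ball p e. mcs (\<rho> x) \<and> fr.good n \<rho> x" for n
  proof -
    obtain e where e: "e > 0" "\<And>x. x \<noteq> p \<Longrightarrow> dist p x < e \<Longrightarrow>
      (\<exists>m\<ge>n. \<exists>\<sigma> N. fr.labelling m (fr.S m a) \<sigma> \<and> open N \<and> x \<in> N \<and> (\<forall>y\<in>N. \<sigma> y = \<rho> y))"
      using \<rho>(2)[of n] by blast
    have other: "mcs (\<rho> x) \<and> fr.good n \<rho> x \<and> type_of (\<Sigma> n) (\<rho> x) \<in> fr.S n a"
      if x: "x \<noteq> p" "dist p x < e" for x
    proof -
      obtain m \<sigma> N where m: "m \<ge> n" "fr.labelling m (fr.S m a) \<sigma>" "open N" "x \<in> N" "\<And>y. y \<in> N \<Longrightarrow> \<sigma> y = \<rho> y"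
        using e(2)[OF x] by blast
      have \<sigma>: "mcs (\<sigma> x)" "fr.good m \<sigma> x" "type_of (\<Sigma> m) (\<sigma> x) \<in> fr.S m a"
        using m(2) unfolding fr.labelling_def by blast+
      have "fr.good m \<rho> x" using fr.good_cong[OF m(3-5) \<sigma>(2)] .
      then have "fr.good n \<rho> x" using good_type_mono \<Sigma>_mono[OF m(1)] fin by blast
      moreover have "type_of (\<Sigma> n) (\<rho> x) \<in> fr.S n a"
      proof -
        obtain c where c: "c \<in> Succ a" "type_of (\<Sigma> m) (\<rho> x) = type_of (\<Sigma> m) c"
          using \<sigma>(3) m(4,5) unfolding fr.S_def by auto
        then have "type_of (\<Sigma> n) (\<rho> x) = type_of (\<Sigma> n) c" using \<Sigma>_mono[OF m(1)] by blast
        then show ?thesis using fr.t_in_S[OF c(1), of n] by simp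
      qed
      ultimately show ?thesis using \<sigma>(1) m(4,5) by auto
    qed
    have "\<exists>x. x \<noteq> p \<and> dist p x < e' \<and> type_of (\<Sigma> n) (\<rho> x) = s" if s: "s \<in> fr.S n a" "e' > 0" for s e'
    proof -
      obtain j where j: "type_of (\<Sigma> n) (v j) = s" using v(2)[OF s(1)] by blast
      obtain M where M: "\<forall>m\<ge>M. \<exists>x. x \<noteq> p \<and> dist p x < e' \<and> A m (\<rho> x)" using \<rho>(3)[OF s(2)] by blast
      obtain m where m: "m \<ge> max M n" "visit m = j" using visit_infinitely_often by blast
      then obtain x where x: "x \<noteq> p" "dist p x < e'" "type_of (\<Sigma> m) (\<rho> x) = type_of (\<Sigma> m) (v j)"
        using M unfolding A_def by auto
      have "type_of (\<Sigma> n) (\<rho> x) = type_of (\<Sigma> n) (v j)" using x(3) \<Sigma>_mono[of n m] m(1) by auto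
      then show ?thesis using x j by auto
    qed
    then have "fr.good n \<rho> p" unfolding fr.good_def \<rho>(1) using other e(1) by blast
    then have "mcs (\<rho> x) \<and> fr.good n \<rho> x" if "x \<in> ball p e" for x
      using other[of x] a \<rho>(1) that by (cases "x = p") auto
    then show ?thesis using e(1) by blast
  qed
  have "truth (\<lambda>p. {x. Atom p \<in> \<rho> x}) p \<phi> \<longleftrightarrow> \<phi> \<in> a" if \<phi>: "\<phi> \<in> \<Sigma> n" for n \<phi>
  proof -
    obtain e where e: "e > 0" "\<forall>x\<in>ball p e. mcs (\<rho> x) \<and> fr.good n \<rho> x" using near by blast
    have "truth (\<lambda>p. {x. Atom p \<in> \<rho> x}) p \<phi> \<longleftrightarrow> \<phi> \<in> \<rho> p"
      by (rule truth_lemma[OF fin \<Sigma>_subs open_ball, of n p e]) (use e \<phi> in auto)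
    then show ?thesis using \<rho>(1) by simp
  qed
  then show ?thesis by blast
qed

theorem KD4G1_strongly_complete:
  "strongly_complete_over (KD4G1 :: 'v fm \<Rightarrow> bool) TYPE('a::{metric_space, perfect_space})"
  unfolding strongly_complete_over_def satisfiable_in_def
proof (intro allI impI, elim conjE)
  fix \<Gamma> :: "'v fm set" assume \<Gamma>: "countable \<Gamma>" "consistent_set KD4G1 \<Gamma>"
  obtain a where a: "mcs a" "\<Gamma> \<subseteq> a" using lindenbaum[OF \<Gamma>(2)] .
  define g where "g = from_nat_into (insert \<^bold>\<top> \<Gamma>)"
  \<comment> \<open>Increasing finite subformula-closed sets that exhaust
    \<open>\<Gamma>\<close>.\<close>
  define \<Sigma> where "\<Sigma> n = (\<Union>i\<le>n. subs (g i))" for n :: nat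
  \<comment> \<open>\<open>undefined\<close> stands for an arbitrary point; the construction works
    at each.\<close>
  have "\<exists>h :: 'v \<Rightarrow> 'a set. \<forall>n. \<forall>\<phi>\<in>\<Sigma> n. truth h undefined \<phi> \<longleftrightarrow> \<phi> \<in> a"
  proof (rule satisfiable_of_mcs[OF a(1)])
    show "finite (\<Sigma> n)" for n by (simp add: \<Sigma>_def finite_subs)
    show "\<Sigma> n \<subseteq> \<Sigma> (Suc n)" for n unfolding \<Sigma>_def by (rule UN_mono) auto
    show "subs \<phi> \<subseteq> \<Sigma> n" if "\<phi> \<in> \<Sigma> n" for n \<phi>
      using that subs_trans unfolding \<Sigma>_def by blast
  qed
  then obtain h :: "'v \<Rightarrow> 'a set" where h: "\<And>n \<phi>. \<phi> \<in> \<Sigma> n \<Longrightarrow> truth h undefined \<phi> \<longleftrightarrow> \<phi> \<in> a"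
    by blast
  have "truth h undefined \<gamma>" if \<gamma>: "\<gamma> \<in> \<Gamma>" for \<gamma>
  proof -
    have "g (to_nat_on (insert \<^bold>\<top> \<Gamma>) \<gamma>) = \<gamma>"
      using \<Gamma>(1) \<gamma> unfolding g_def by simp
    then have "\<gamma> \<in> \<Sigma> (to_nat_on (insert \<^bold>\<top> \<Gamma>) \<gamma>)"
      unfolding \<Sigma>_def using self_in_subs[of \<gamma>] by force
    then show ?thesis using h a(2) \<gamma> by blast
  qed
  then show "\<exists>(h :: 'v \<Rightarrow> 'a set) x. \<forall>\<gamma>\<in>\<Gamma>. truth h x \<gamma>" by blast
qed

section \<open>Soundness\<close>

lemma truth_psubst: "truth h x (psubst \<sigma> \<alpha>) \<longleftrightarrow> peval (\<lambda>n. truth h x (\<sigma> n)) \<alpha>"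
  by (induction \<alpha>) auto

theorem KD4G1_sound:
  assumes "scheme_valid_in TYPE('a::{t1_space, perfect_space}) (G1 :: 'v fm set)"
  shows "sound_over (KD4G1 :: 'v fm \<Rightarrow> bool) TYPE('a)"
  unfolding sound_over_def valid_in_def
proof (intro allI impI)
  fix \<phi> :: "'v fm" and h :: "'v \<Rightarrow> 'a set" and x
  assume "KD4G1 \<phi>"
  then show "truth h x \<phi>"
  proof (induction arbitrary: x)
    case (Taut \<phi>)
    then show ?case by (auto simp: taut_instances_def truth_psubst)
  next
    case (K \<phi> \<psi>)
    have "truth h x (\<box> \<psi>)" if "truth h x (\<box> (\<phi> \<^bold>\<longrightarrow> \<psi>))" "truth h x (\<box> \<phi>)"
    proof -
      obtain U V where "open U" "x \<in> U" "\<forall>y\<in>U - {x}. truth h y (\<phi> \<^bold>\<longrightarrow> \<psi>)"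
        "open V" "x \<in> V" "\<forall>y\<in>V - {x}. truth h y \<phi>"
        using \<open>truth h x (\<box> (\<phi> \<^bold>\<longrightarrow> \<psi>))\<close> \<open>truth h x (\<box> \<phi>)\<close> by (metis truth.simps(5))
      then have "open (U \<inter> V)" "x \<in> U \<inter> V" "\<forall>y\<in>U \<inter> V - {x}. truth h y \<psi>"
        by auto
      then show ?thesis unfolding truth.simps by blast
    qed
    then show ?case by (simp only: truth.simps) blast
  next
    case D
    have False if "open U" "x \<in> U" "U - {x} = {}" for U
    proof -
      have "U = {x}" using that by blast
      then show False using that(1) not_open_singleton by blast
    qed
    then show ?case by (simp only: truth.simps) blast
  next
    case (Four \<phi>)
    have "truth h x (\<box> (\<box> \<phi>))" if box: "truth h x (\<box> \<phi>)"
    proof -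
      obtain U where U: "open U" "x \<in> U" "\<forall>y\<in>U - {x}. truth h y \<phi>"
        using box by auto
      have "truth h y (\<box> \<phi>)" if "y \<in> U - {x}" for y
        \<comment> \<open>The point \<open>x\<close> must be deleted because \<open>\<phi>\<close>
          may fail there; what remains is open since points are closed.\<close>
        unfolding truth.simps using U that by (intro exI[of _ "U - {x}"]) (auto simp: open_delete)
      then show ?thesis using U by auto
    qed
    then show ?case by (simp only: truth.simps) blast
  next
    case (G \<phi>)
    then show ?case using assms by (auto simp: scheme_valid_in_def valid_in_def)
  next
    case (Nec \<phi>)
    then show ?case using open_UNIV by auto
  qed auto
qed

theorem theorem10p2:
  shows "strongly_complete_over (KD4G1 :: 'v fm \<Rightarrow> bool) TYPE('a::{metric_space, perfect_space})
    \<and> (scheme_valid_in TYPE('a) (G1 :: 'v fm set)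
        \<longrightarrow> sound_over (KD4G1 :: 'v fm \<Rightarrow> bool) TYPE('a))"
  using KD4G1_strongly_complete KD4G1_sound by blast

end
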